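(* To any observed solution of $\widehat{(YM)}$ one can associate the geometric objects $$\hat E=\dot\psi\rfloor\tilde R=Z_K\otimes\hat E^K_\alpha dx^\alpha=Z_K\otimes\tilde R^K_{\beta\alpha}\dot\psi^\beta dx^\alpha:N\to\mathfrak g\otimes_{\mathbb R}T^*N\quad\text{(quantum electric-charge field)},$$ $$\hat B=\dot\psi\rfloor(\star\tilde R)=Z_K\otimes\hat B^K_\mu dx^\mu=Z_K\otimes\epsilon^{\kappa\lambda}_{\mu\nu}\tilde R^K_{\kappa\lambda}\dot\psi^\nu dx^\mu:N\to\mathfrak g\otimes_{\mathbb R}T^*N\quad\text{(quantum magnetic-charge field)}.$$ In coordinates $\{\xi^\alpha\}_{0\le\alpha\le3}$ adapted to the quantum relativistic frame, $$\hat E=Z_K\otimes\hat E^K_id\xi^i=Z_K\otimes\tilde R^K_{0i}d\xi^i,\qquad \hat B=Z_K\otimes\hat B^K_id\xi^i=Z_K\otimes\epsilon^{rs}_{m0}\tilde R^K_{rs}d\xi^m,$$ with $\hat E^K_i(p),\hat B^K_i(p)\in A$ for all $p\in N$; i.e. $\hat E$ and $\hat B$ are $A$-valued space-like objects. One has the splittings $$\hat E=\hat E_{\mathrm v}+\hat E_{\mathrm L}+\hat E_{\mathrm d},\qquad \hat B=\hat B_{\mathrm v}+\hat B_{\mathrm L}+\hat B_{\mathrm d}.$$ If the solution has a spin-structure, then $\hat E_{\mathrm v}=0$, and $\hat B_{\mathrm v}$ is related to the quantum spin-vector field $\widetilde s$ by $$\hat\theta^\gamma_K\,(\hat B_{\mathrm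 v})^K_\mu=-\dot\psi^\gamma\,\widetilde s_\mu,\qquad\text{hence in frame-adapted coordinates}\quad \hat\theta^0_K\,(\hat B_{\mathrm v})^K_i=-\widetilde s_i .$$ Therefore, in an observed solution with spin-structure, $-\hat B_{\mathrm v}$ identifies a distribution of quantum spin-vector fields $\widetilde s^k=g^{ki}\widetilde s_i$, and $\hat B_{\mathrm v}$ determines the spectral-spin-classification of the solution.
   Context: Setting. $A$ is a quantum superalgebra (unital associative $\mathbb Z_2$-graded Fréchet $\mathbb K$-algebra, $\mathbb K=\mathbb R$ or $\mathbb C$, with Noetherian center $Z$); $M$ a quantum supermanifold over $A$; $\mathbf N$ the 4-dimensional Minkowski vector space. $\mathfrak g$ is a quantum superextension of the Poincaré Lie algebra with splitting $\mathfrak g=\mathfrak g_{\mathrm v}+\mathfrak g_{\mathrm L}+\mathfrak g_{\mathrm d}$, $\mathfrak g_{\mathrm v}=A\otimes_{\mathbb R}\mathbf N$, $\mathfrak g_{\mathrm L}$ the extension of the Lorentz part; $(Z_K)$ is a basis of its quantum extension adapted to the splitting, $\hat C^K_{IJ}$ the structure constants. $\widehat{(YM)}$ is the equation $-\partial_B\hat R^{BA}_K+[\hat C^H_{KR}\hat\mu^R_C,\hat R^{[AC]}_H]_+=0$ for sections $\hat\mu=Z_K\otimes\hat\mu^K_Adx^A$ of $Hom_Z(TM;\mathfrak g)\to M$, with $\hat R=Z_K\otimes\hat R^K_{AB}dx^A\triangle dx^B$ the curvature of $\hat\mu$. Subscripts v, L, d denote components along the three summands. $\hat\mu_{\mathrm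 v}=\hat\theta$ is the quantum vierbein (pointwise an isomorphism $T_pM\cong A\otimes\mathbf N$), with components $\hat\theta^K_\alpha$ and inverse components $\hat\theta^\alpha_K$: $\hat\theta^H_\lambda\hat\theta^\lambda_K=\delta^H_K$. Frame. A quantum relativistic frame is a map $i:N\to M$ from 4-dimensional Minkowski space-time $(N,g)$ with a time-like foliation of velocity field $\dot\psi$. Observed objects are pullbacks: $\tilde R=i^*\hat R$, with $\tilde R^K_{\alpha\beta}(p)\in A$ antisymmetric in $\alpha,\beta$. In adapted coordinates $\dot\psi=\partial\xi_0$, $g_{00}=1$, $g_{0i}=0$. $\epsilon_{\mu\nu\lambda\rho}=\sqrt{|g|}\,\delta^{0123}_{\mu\nu\lambda\rho}$ is the completely antisymmetric symbol, and $\epsilon^{\kappa\lambda}_{\mu\nu}=g^{\kappa\alpha}g^{\lambda\beta}\epsilon_{\alpha\beta\mu\nu}$. Spin structure. The observed quantum torsion is $\widetilde S^\gamma_{\alpha\beta}=\hat\theta^\gamma_K(\tilde R_{\mathrm v})^K_{\alpha\beta}$. The solution has a spin-structure if there is an $A$-valued 2-form $\widetilde s_{\alpha\beta}=-\widetilde s_{\beta\alpha}$ on $N$ with $\widetilde S^\lambda_{\alpha\beta}=\widetilde s_{\alpha\beta}\dot\psi^\lambda$ and $\widetilde S^\lambda_{\alpha\beta}\dot\psi^\alpha=0$. The quantum spin-vector field has components $\widetilde s_\rho=\epsilon_{\mu\nu\lambda\rho}\dot\psi^\mu\widetilde s^{\nu\lambda}$ (indices raised with $g$). Spectral-spin-classification.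 Put $|\widetilde s|^2=\widetilde s^\rho\widetilde s_\rho$, $\mathfrak b=\{\hbar^2s(s+1):s\in\mathbb N\}$, $\mathfrak f=\{\hbar^2s(s+1):s=\frac{2n+1}2,n\in\mathbb N\}$, $\mathfrak c=\{\hbar m_s: m_s=-s,\dots,s\}$. At $p$ the solution is bosonic-polarized if $Sp(|\widetilde s(p)|^2)\subset\mathfrak b$ and $Sp(\widetilde s_z(p))\subset\mathfrak c$; fermionic-polarized if $Sp(|\widetilde s(p)|^2)\subset\mathfrak f$ and $Sp(\widetilde s_z(p))\subset\mathfrak c$; unpolarized if $Sp(|\widetilde s(p)|^2)$ meets neither $\mathfrak b$ nor $\mathfrak f$; mixt-polarized if it meets $\mathfrak b$ and/or $\mathfrak f$. The quantum content of $\hat E,\hat B$ at $p$ is by definition given by the spectra of $\hat E^K_i(p),\hat B^K_i(p)$. *)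

theory Defs
  imports "HOL-Analysis.Analysis" "HOL-Algebra.Ring_Divisibility"
begin

section \<open>Quantum superalgebras\<close>

definition center :: "'a::ring_1 set" where
  "center = {z. \<forall>a. z * a = a * z}"

definition center_ring :: "'a::ring_1 ring" where
  "center_ring = \<lparr>carrier = center, monoid.mult = (*), one = 1, zero = 0, add = (+)\<rparr>"

text \<open>A scalar field of class \<open>real_normed_field\<close> is, by Gelfand--Mazur, either the field of
  real numbers or the field of complex numbers; this is how the choice of the ground field is left
  open.\<close>

locale quantum_superalgebra =
  fixes smul :: "'f::real_normed_field
      \<Rightarrow> 'a::{real_algebra_1, t2_space, topological_ab_group_add, topological_semigroup_mult} \<Rightarrow> 'a"
    and A0 A1 :: "'a set"
  assumes vector_space: "vector_space smul"
    and scale_mult_left: "smul c (a * b) = smul c a * b"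
    and scale_mult_right: "smul c (a * b) = a * smul c b"
    and scale_of_real: "smul (of_real r) a = r *\<^sub>R a"
    and frechet: "\<exists>sn :: nat \<Rightarrow> 'a \<Rightarrow> real.
        (\<forall>n a b. sn n (a + b) \<le> sn n a + sn n b) \<and>
        (\<forall>n c a. sn n (smul c a) = norm c * sn n a) \<and>
        (\<forall>S. open S \<longleftrightarrow> (\<forall>a\<in>S. \<exists>n. \<exists>e>0. {b. \<forall>j\<le>n. sn j (b - a) < e} \<subseteq> S)) \<and>
        (\<forall>X :: nat \<Rightarrow> 'a. (\<forall>n. \<forall>e>0. \<exists>N. \<forall>j\<ge>N. \<forall>k\<ge>N. sn n (X j - X k) < e) \<longrightarrow> convergent X)"
    and even_part: "module.subspace smul A0" "closed A0"
    and odd_part: "module.subspace smul A1" "closed A1"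
    and graded_sum: "A0 \<inter> A1 = {0}" "\<forall>a. \<exists>b\<in>A0. \<exists>c\<in>A1. a = b + c"
    and graded_one: "1 \<in> A0"
    and graded_mult:
      "a \<in> A0 \<Longrightarrow> b \<in> A0 \<Longrightarrow> a * b \<in> A0" "a \<in> A0 \<Longrightarrow> b \<in> A1 \<Longrightarrow> a * b \<in> A1"
      "a \<in> A1 \<Longrightarrow> b \<in> A0 \<Longrightarrow> a * b \<in> A1" "a \<in> A1 \<Longrightarrow> b \<in> A1 \<Longrightarrow> a * b \<in> A0"
    and noetherian_center: "noetherian_ring (center_ring :: 'a ring)"

definition spectrum :: "('f::real_normed_field \<Rightarrow> 'a::ring_1 \<Rightarrow> 'a) \<Rightarrow> 'a \<Rightarrow> 'f set" where
  "spectrum smul a = {l. \<not> (\<exists>b. (a - smul l 1) * b = 1 \<and> b * (a - smul l 1) = 1)}"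

definition acomm :: "'a::ring_1 \<Rightarrow> 'a \<Rightarrow> 'a" where
  "acomm a b = a * b + b * a"

definition mutually_inverse ::
  "'i set \<Rightarrow> 'j set \<Rightarrow> ('i \<Rightarrow> 'j \<Rightarrow> 'a::ring_1) \<Rightarrow> ('j \<Rightarrow> 'i \<Rightarrow> 'a) \<Rightarrow> bool" where
  "mutually_inverse I J T W \<longleftrightarrow>
     (\<forall>h\<in>I. \<forall>k\<in>I. (\<Sum>l\<in>J. T h l * W l k) = (if h = k then 1 else 0)) \<and>
     (\<forall>l\<in>J. \<forall>m\<in>J. (\<Sum>k\<in>I. W l k * T k m) = (if l = m then 1 else 0))"

section \<open>Quantum differentiability and quantum supermanifolds\<close>

definition zscale :: "'a::ring_1 \<Rightarrow> 'a^'n \<Rightarrow> 'a^'n" where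
  "zscale z v = (\<chi> j. z * v $ j)"

definition Z_linear_wrt :: "('a::ring_1 \<Rightarrow> 'x \<Rightarrow> 'x) \<Rightarrow> ('a \<Rightarrow> 'y \<Rightarrow> 'y)
    \<Rightarrow> ('x::ab_group_add \<Rightarrow> 'y::ab_group_add) \<Rightarrow> bool" where
  "Z_linear_wrt sx sy f \<longleftrightarrow>
     (\<forall>v w. f (v + w) = f v + f w) \<and> (\<forall>z\<in>center. \<forall>v. f (sx z v) = sy z (f v))"

abbreviation Z_linear :: "('a::ring_1^'n \<Rightarrow> 'a^'l) \<Rightarrow> bool" where
  "Z_linear \<equiv> Z_linear_wrt zscale zscale"

definition has_weak_derivative ::
  "('x::real_vector \<Rightarrow> 'y::{real_vector, topological_space}) \<Rightarrow> 'x \<Rightarrow> ('x \<Rightarrow> 'y) \<Rightarrow> bool" where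
  "has_weak_derivative f x D \<longleftrightarrow>
     (\<forall>v. ((\<lambda>t::real. (f (x + t *\<^sub>R v) - f x) /\<^sub>R t) \<longlongrightarrow> D v) (at 0))"

definition wderiv ::
  "('x::real_vector \<Rightarrow> 'y::{real_vector, topological_space}) \<Rightarrow> 'x \<Rightarrow> 'x \<Rightarrow> 'y" where
  "wderiv f x v = (THE l. ((\<lambda>t::real. (f (x + t *\<^sub>R v) - f x) /\<^sub>R t) \<longlongrightarrow> l) (at 0))"

text \<open>\<open>weak_C k L U f\<close>: on the open set \<open>U\<close> the map \<open>f\<close> is \<open>k\<close> times weakly (Gateaux)
  differentiable, with jointly continuous derivatives all of which belong to the class \<open>L\<close> of
  linear maps. Taking for \<open>L\<close> the maps that are linear over the center gives the classes of
  quantum differentiability.\<close>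

primrec weak_C :: "nat \<Rightarrow> (('x \<Rightarrow> 'y) \<Rightarrow> bool) \<Rightarrow> 'x::{real_vector, topological_space} set
    \<Rightarrow> ('x \<Rightarrow> 'y::{real_vector, topological_space}) \<Rightarrow> bool" where
  "weak_C 0 L U f \<longleftrightarrow> continuous_on U f"
| "weak_C (Suc k) L U f \<longleftrightarrow> continuous_on U f \<and>
     (\<exists>D. (\<forall>x\<in>U. L (D x) \<and> has_weak_derivative f x (D x)) \<and>
          continuous_on (U \<times> UNIV) (\<lambda>(x, v). D x v) \<and>
          (\<forall>v. weak_C k L U (\<lambda>x. D x v)))"

type_synonym ('m, 'a, 'd) qchart = "'m set \<times> ('m \<Rightarrow> 'a^'d)"

definition chart_inv :: "('m, 'a, 'd) qchart \<Rightarrow> 'a^'d \<Rightarrow> 'm" where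
  "chart_inv c = inv_into (fst c) (snd c)"

text \<open>The local model is the space of \<open>d\<close>-tuples in \<open>A\<close>, that is
  \<open>A\<^sup>d\<^sup>|\<^sup>d = A\<^sub>0\<^sup>d \<times> A\<^sub>1\<^sup>d\<close> with each even coordinate and its odd partner
  combined into one \<open>A\<close>-valued coordinate. Only models of this shape are compatible with a vierbein
  identifying the tangent spaces with \<open>A \<otimes> \<real>\<^sup>4\<close>.\<close>

definition quantum_supermanifold ::
  "('m::t2_space, 'a::{real_algebra_1, topological_space}, 'd::finite) qchart set \<Rightarrow> bool" where
  "quantum_supermanifold atlas \<longleftrightarrow>
     (\<Union>c\<in>atlas. fst c) = UNIV \<and>
     (\<forall>c\<in>atlas. open (fst c) \<and> open (snd c ` fst c) \<and>
        homeomorphism (fst c) (snd c ` fst c) (snd c) (chart_inv c)) \<and>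
     (\<forall>c\<in>atlas. \<forall>c'\<in>atlas. \<forall>k.
        weak_C k Z_linear (snd c ` (fst c \<inter> fst c')) (snd c' \<circ> chart_inv c))"

definition trans_deriv ::
  "('m, 'a::{real_algebra_1, topological_space}, 'd::finite) qchart \<Rightarrow> ('m, 'a, 'd) qchart
     \<Rightarrow> 'm \<Rightarrow> 'a^'d \<Rightarrow> 'a^'d" where
  "trans_deriv c c' q = wderiv (snd c' \<circ> chart_inv c) (snd c q)"

definition chart_deriv ::
  "('m, 'a::{real_algebra_1, topological_space}, 'd::finite) qchart
     \<Rightarrow> ('m \<Rightarrow> 'y::{real_vector, topological_space}) \<Rightarrow> 'm \<Rightarrow> 'a^'d \<Rightarrow> 'y" where
  "chart_deriv c f q v = wderiv (f \<circ> chart_inv c) (snd c q) v"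

section \<open>Minkowski space-time\<close>

text \<open>Minkowski space-time and its translation space are both \<open>real^4\<close>, through an inertial
  coordinate system; the signature is \<open>(+,-,-,-)\<close>, as forced by \<open>g\<^sub>0\<^sub>0 = 1\<close>.\<close>

definition eta :: "4 \<Rightarrow> 4 \<Rightarrow> real" where
  "eta i j = (if i = j then (if i = 0 then 1 else -1) else 0)"

definition mink :: "real^4 \<Rightarrow> real^4 \<Rightarrow> real" where
  "mink v w = (\<Sum>i\<in>UNIV. \<Sum>j\<in>UNIV. eta i j * v $ i * w $ j)"

definition vol4 :: "real^4 \<Rightarrow> real^4 \<Rightarrow> real^4 \<Rightarrow> real^4 \<Rightarrow> real" where
  "vol4 a b c d = det ((\<chi> i. if i = 0 then a else if i = 1 then b else if i = 2 then c else d)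
     :: real^4^4)"

definition delta0123 :: "4 \<Rightarrow> 4 \<Rightarrow> 4 \<Rightarrow> 4 \<Rightarrow> real" where
  "delta0123 m n l r = vol4 (axis m 1) (axis n 1) (axis l 1) (axis r 1)"

primrec C_on :: "nat \<Rightarrow> 'x::euclidean_space set \<Rightarrow> ('x \<Rightarrow> 'y::real_normed_vector) \<Rightarrow> bool" where
  "C_on 0 U f \<longleftrightarrow> continuous_on U f"
| "C_on (Suc k) U f \<longleftrightarrow> (\<forall>x\<in>U. f differentiable (at x)) \<and>
     (\<forall>v. C_on k U (\<lambda>x. frechet_derivative f (at x) v))"

type_synonym nchart = "(real^4) set \<times> (real^4 \<Rightarrow> real^4)"

definition coord_field :: "nchart \<Rightarrow> real^4 \<Rightarrow> 4 \<Rightarrow> real^4" where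
  "coord_field x p a = frechet_derivative (inv_into (fst x) (snd x)) (at (snd x p)) (axis a 1)"

definition vcomp :: "nchart \<Rightarrow> real^4 \<Rightarrow> real^4 \<Rightarrow> 4 \<Rightarrow> real" where
  "vcomp x p X a = frechet_derivative (snd x) (at p) X $ a"

text \<open>Coordinate systems are positively oriented, because the symbol \<open>\<epsilon>\<close> below is a tensor only
  under orientation preserving changes of coordinates.\<close>

definition coordinate_system :: "nchart \<Rightarrow> bool" where
  "coordinate_system x \<longleftrightarrow>
     open (fst x) \<and> inj_on (snd x) (fst x) \<and> open (snd x ` fst x) \<and>
     (\<forall>k. C_on k (fst x) (snd x)) \<and> (\<forall>k. C_on k (snd x ` fst x) (inv_into (fst x) (snd x))) \<and>
     (\<forall>p\<in>fst x. 0 < vol4 (coord_field x p 0) (coord_field x p 1) (coord_field x p 2)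
                          (coord_field x p 3))"

definition gmat :: "nchart \<Rightarrow> real^4 \<Rightarrow> real^4^4" where
  "gmat x p = (\<chi> a b. mink (coord_field x p a) (coord_field x p b))"

definition metric_inv :: "nchart \<Rightarrow> real^4 \<Rightarrow> real^4^4" where
  "metric_inv x p = matrix_inv (gmat x p)"

definition eps :: "nchart \<Rightarrow> real^4 \<Rightarrow> 4 \<Rightarrow> 4 \<Rightarrow> 4 \<Rightarrow> 4 \<Rightarrow> real" where
  "eps x p m n l r = sqrt \<bar>det (gmat x p)\<bar> * delta0123 m n l r"

text \<open>\<open>eps_up x p k l m n\<close> stands for \<open>\<epsilon>\<^bsup>kl\<^esup>\<^bsub>mn\<^esub>\<close>.\<close>

definition eps_up :: "nchart \<Rightarrow> real^4 \<Rightarrow> 4 \<Rightarrow> 4 \<Rightarrow> 4 \<Rightarrow> 4 \<Rightarrow> real" where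
  "eps_up x p k l m n =
     (\<Sum>a\<in>UNIV. \<Sum>b\<in>UNIV. metric_inv x p $ k $ a * metric_inv x p $ l $ b * eps x p a b m n)"

definition contraction :: "(real^4 \<Rightarrow> real^4) \<Rightarrow> (real^4 \<Rightarrow> real^4 \<Rightarrow> real^4 \<Rightarrow> 'y)
    \<Rightarrow> real^4 \<Rightarrow> real^4 \<Rightarrow> 'y" where
  "contraction \<psi> \<omega> p X = \<omega> p (\<psi> p) X"

text \<open>The star of a 2-form, written in inertial coordinates. Normalization and the order of the
  last two arguments of the volume form are the ones for which contracting the first slot of
  \<open>\<star>\<omega>\<close> with a vector \<open>\<psi>\<close> gives the components
  \<open>\<epsilon>\<^bsup>kl\<^esup>\<^bsub>mn\<^esub> \<omega>\<^bsub>kl\<^esub> \<psi>\<^sup>n\<close>.\<close>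

definition star :: "(real^4 \<Rightarrow> real^4 \<Rightarrow> real^4 \<Rightarrow> 'y::real_vector)
    \<Rightarrow> real^4 \<Rightarrow> real^4 \<Rightarrow> real^4 \<Rightarrow> 'y" where
  "star \<omega> p X Y = (\<Sum>k\<in>UNIV. \<Sum>l\<in>UNIV. \<Sum>a\<in>UNIV. \<Sum>b\<in>UNIV.
     (eta k a * eta l b * vol4 (axis a 1) (axis b 1) Y X) *\<^sub>R \<omega> p (axis k 1) (axis l 1))"

section \<open>Quantum superextensions of the Poincare algebra\<close>

definition lorentz_algebra :: "(real^4^4) set" where
  "lorentz_algebra = {L. \<forall>v w. mink (L *v v) w + mink v (L *v w) = 0}"

definition poincare_bracket ::
  "(real^4^4) \<times> (real^4) \<Rightarrow> (real^4^4) \<times> (real^4) \<Rightarrow> (real^4^4) \<times> (real^4)" where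
  "poincare_bracket x y =
     (fst x ** fst y - fst y ** fst x, fst x *v snd y - fst y *v snd x)"

text \<open>The quantum extension of the superalgebra is the right module of columns \<open>'a^'k\<close>, the
  \<open>K\<close>-th entry being the coefficient of the basis element \<open>Z\<^sub>K\<close>, and \<open>C K I J\<close> is the structure
  constant of \<open>[Z\<^sub>I, Z\<^sub>J]\<close> along \<open>Z\<^sub>K\<close>. The index sets \<open>Kv\<close>, \<open>KL\<close> and their common complement
  describe the splitting; \<open>odd_idx\<close> is the parity of the basis elements; \<open>gen\<close> sends the indices in
  \<open>Kv \<union> KL\<close> to the elements of the Poincare algebra which the basis elements extend. The
  brackets of these basis elements are those of the Poincare algebra up to terms in the third
  summand.\<close>

definition poincare_superextension ::
  "'a::real_algebra_1 set \<Rightarrow> 'a set \<Rightarrow> 'k::finite set \<Rightarrow> 'k set \<Rightarrow> ('k \<Rightarrow> bool)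
     \<Rightarrow> ('k \<Rightarrow> (real^4^4) \<times> (real^4)) \<Rightarrow> ('k \<Rightarrow> 'k \<Rightarrow> 'k \<Rightarrow> 'a) \<Rightarrow> bool" where
  "poincare_superextension A0 A1 Kv KL odd_idx gen C \<longleftrightarrow>
     (let sg = (\<lambda>I J. if odd_idx I \<and> odd_idx J then -1 else 1 :: 'a) in
     Kv \<inter> KL = {} \<and>
     (\<forall>K\<in>Kv \<union> KL. \<not> odd_idx K) \<and>
     inj_on gen (Kv \<union> KL) \<and> independent (gen ` (Kv \<union> KL)) \<and>
     span (gen ` Kv) = {(0, a) | a. True} \<and>
     span (gen ` KL) = {(L, 0) | L. L \<in> lorentz_algebra} \<and>
     (\<forall>K I J. C K I J \<in> (if (odd_idx I \<noteq> odd_idx J) \<noteq> odd_idx K then A1 else A0)) \<and>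
     (\<forall>K I J. C K I J = - sg I J * C K J I) \<and>
     (\<forall>H I J K. (\<Sum>L\<in>UNIV. sg I K * (C H I L * C L J K) + sg J I * (C H J L * C L K I)
                          + sg K J * (C H K L * C L I J)) = 0) \<and>
     (\<forall>I\<in>Kv \<union> KL. \<forall>J\<in>Kv \<union> KL. \<exists>c :: 'k \<Rightarrow> real.
        (\<forall>K\<in>Kv \<union> KL. C K I J = of_real (c K)) \<and>
        poincare_bracket (gen I) (gen J) = (\<Sum>K\<in>Kv \<union> KL. c K *\<^sub>R gen K)))"

definition summand :: "'k set \<Rightarrow> 'a::zero^'k \<Rightarrow> 'a^'k" where
  "summand S X = (\<chi> K. if K \<in> S then X $ K else 0)"

definition bracket :: "('k \<Rightarrow> 'k \<Rightarrow> 'k \<Rightarrow> 'a::real_algebra_1) \<Rightarrow> 'a^'k::finite \<Rightarrow> 'a^'k \<Rightarrow> 'a^'k" where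
  "bracket C X Y = (\<chi> K. \<Sum>I\<in>UNIV. \<Sum>J\<in>UNIV. C K I J * ((1/2) *\<^sub>R acomm (X $ I) (Y $ J)))"

section \<open>Quantum Yang--Mills equation\<close>

text \<open>A section of \<open>Hom\<^sub>Z(TM; \<gg>)\<close> is given by its representatives \<open>\<mu> c q\<close> in the charts \<open>c\<close>;
  the column \<open>\<mu> c q (axis B 1)\<close> has the entries \<open>\<mu>\<^sup>K\<^sub>B(q)\<close>.\<close>

definition quantum_connection ::
  "('m::t2_space, 'a::{real_algebra_1, topological_space}, 'd::finite) qchart set
     \<Rightarrow> (('m, 'a, 'd) qchart \<Rightarrow> 'm \<Rightarrow> 'a^'d \<Rightarrow> 'a^'k::finite) \<Rightarrow> bool" where
  "quantum_connection atlas \<mu> \<longleftrightarrow>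
     (\<forall>c\<in>atlas. \<forall>q\<in>fst c. Z_linear (\<mu> c q)) \<and>
     (\<forall>c\<in>atlas. \<forall>c'\<in>atlas. \<forall>q\<in>fst c \<inter> fst c'. \<forall>v. \<mu> c' q (trans_deriv c c' q v) = \<mu> c q v) \<and>
     (\<forall>c\<in>atlas. continuous_on (snd c ` fst c \<times> UNIV) (\<lambda>(y, v). \<mu> c (chart_inv c y) v)) \<and>
     (\<forall>c\<in>atlas. \<forall>k v. weak_C k Z_linear (snd c ` fst c) (\<lambda>y. \<mu> c (chart_inv c y) v))"

text \<open>The curvature \<open>d\<mu> + [\<mu>, \<mu>]/2\<close>, where
  \<open>[\<mu>, \<mu>](v, w) = [\<mu> v, \<mu> w] - [\<mu> w, \<mu> v]\<close>.\<close>

definition curvature ::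
  "('k \<Rightarrow> 'k \<Rightarrow> 'k \<Rightarrow> 'a::{real_algebra_1, topological_space})
     \<Rightarrow> (('m, 'a, 'd::finite) qchart \<Rightarrow> 'm \<Rightarrow> 'a^'d \<Rightarrow> 'a^'k::finite)
     \<Rightarrow> ('m, 'a, 'd) qchart \<Rightarrow> 'm \<Rightarrow> 'a^'d \<Rightarrow> 'a^'d \<Rightarrow> 'a^'k" where
  "curvature C \<mu> c q v w =
     chart_deriv c (\<lambda>r. \<mu> c r w) q v - chart_deriv c (\<lambda>r. \<mu> c r v) q w
     + (1/2) *\<^sub>R (bracket C (\<mu> c q v) (\<mu> c q w) - bracket C (\<mu> c q w) (\<mu> c q v))"

definition quantum_metric ::
  "('m::t2_space, 'a::{real_algebra_1, topological_space}, 'd::finite) qchart set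
     \<Rightarrow> (('m, 'a, 'd) qchart \<Rightarrow> 'm \<Rightarrow> 'a^'d \<Rightarrow> 'a^'d \<Rightarrow> 'a) \<Rightarrow> bool" where
  "quantum_metric atlas G \<longleftrightarrow>
     (\<forall>c\<in>atlas. \<forall>q\<in>fst c. \<forall>v. Z_linear_wrt zscale (*) (G c q v) \<and>
        Z_linear_wrt zscale (*) (\<lambda>w. G c q w v)) \<and>
     (\<forall>c\<in>atlas. \<forall>c'\<in>atlas. \<forall>q\<in>fst c \<inter> fst c'. \<forall>v w.
        G c' q (trans_deriv c c' q v) (trans_deriv c c' q w) = G c q v w) \<and>
     (\<forall>c\<in>atlas. \<forall>k v w.
        weak_C k (Z_linear_wrt zscale (*)) (snd c ` fst c) (\<lambda>y. G c (chart_inv c y) v w)) \<and>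
     (\<forall>c\<in>atlas. \<forall>q\<in>fst c.
        \<exists>W. mutually_inverse UNIV UNIV (\<lambda>A B. G c q (axis A 1) (axis B 1)) W)"

definition quantum_metric_inv ::
  "(('m, 'a::real_algebra_1, 'd::finite) qchart \<Rightarrow> 'm \<Rightarrow> 'a^'d \<Rightarrow> 'a^'d \<Rightarrow> 'a)
     \<Rightarrow> ('m, 'a, 'd) qchart \<Rightarrow> 'm \<Rightarrow> 'd \<Rightarrow> 'd \<Rightarrow> 'a" where
  "quantum_metric_inv G c q =
     (SOME W. mutually_inverse UNIV UNIV (\<lambda>A B. G c q (axis A 1) (axis B 1)) W)"

text \<open>\<open>curvature_up \<kappa> G C \<mu> c q B A K\<close> stands for \<open>R\<^bsup>BA\<^esup>\<^bsub>K\<^esub>\<close>: form indices are raised with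
  a metric \<open>G\<close> of the manifold, the algebra index is lowered with a matrix \<open>\<kappa>\<close>.\<close>

definition curvature_up ::
  "('k \<Rightarrow> 'k \<Rightarrow> 'a::{real_algebra_1, topological_space})
     \<Rightarrow> (('m, 'a, 'd::finite) qchart \<Rightarrow> 'm \<Rightarrow> 'a^'d \<Rightarrow> 'a^'d \<Rightarrow> 'a)
     \<Rightarrow> ('k \<Rightarrow> 'k \<Rightarrow> 'k \<Rightarrow> 'a)
     \<Rightarrow> (('m, 'a, 'd) qchart \<Rightarrow> 'm \<Rightarrow> 'a^'d \<Rightarrow> 'a^'k::finite)
     \<Rightarrow> ('m, 'a, 'd) qchart \<Rightarrow> 'm \<Rightarrow> 'd \<Rightarrow> 'd \<Rightarrow> 'k \<Rightarrow> 'a" where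
  "curvature_up \<kappa> G C \<mu> c q B A K =
     (\<Sum>H\<in>UNIV. \<Sum>D\<in>UNIV. \<Sum>E\<in>UNIV. \<kappa> K H * quantum_metric_inv G c q B D *
        quantum_metric_inv G c q A E * curvature C \<mu> c q (axis D 1) (axis E 1) $ H)"

definition yang_mills ::
  "('m::t2_space, 'a::{real_algebra_1, topological_space}, 'd::finite) qchart set
     \<Rightarrow> ('k \<Rightarrow> 'k \<Rightarrow> 'a) \<Rightarrow> (('m, 'a, 'd) qchart \<Rightarrow> 'm \<Rightarrow> 'a^'d \<Rightarrow> 'a^'d \<Rightarrow> 'a)
     \<Rightarrow> ('k \<Rightarrow> 'k \<Rightarrow> 'k \<Rightarrow> 'a)
     \<Rightarrow> (('m, 'a, 'd) qchart \<Rightarrow> 'm \<Rightarrow> 'a^'d \<Rightarrow> 'a^'k::finite) \<Rightarrow> bool" where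
  "yang_mills atlas \<kappa> G C \<mu> \<longleftrightarrow>
     (\<forall>c\<in>atlas. \<forall>q\<in>fst c. \<forall>A K.
        - (\<Sum>B\<in>UNIV. chart_deriv c (\<lambda>r. curvature_up \<kappa> G C \<mu> c r B A K) q (axis B 1))
        + (\<Sum>H\<in>UNIV. \<Sum>R\<in>UNIV. \<Sum>F\<in>UNIV.
             acomm (C H K R * \<mu> c q (axis F 1) $ R)
               ((1/2) *\<^sub>R (curvature_up \<kappa> G C \<mu> c q A F H - curvature_up \<kappa> G C \<mu> c q F A H)))
        = 0)"

definition vierbein ::
  "('m, 'a::real_algebra_1, 'd::finite) qchart set \<Rightarrow> 'k set
     \<Rightarrow> (('m, 'a, 'd) qchart \<Rightarrow> 'm \<Rightarrow> 'a^'d \<Rightarrow> 'a^'k::finite) \<Rightarrow> bool" where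
  "vierbein atlas Kv \<mu> \<longleftrightarrow>
     (\<forall>c\<in>atlas. \<forall>q\<in>fst c. bij_betw (\<lambda>v. summand Kv (\<mu> c q v)) UNIV (range (summand Kv)))"

section \<open>Quantum relativistic frames and observed objects\<close>

definition relativistic_frame ::
  "('m::t2_space, 'a::{real_algebra_1, topological_space}, 'd::finite) qchart set
     \<Rightarrow> (real^4 \<Rightarrow> 'm) \<Rightarrow> (real^4 \<Rightarrow> real^4) \<Rightarrow> bool" where
  "relativistic_frame atlas i \<psi> \<longleftrightarrow>
     continuous_on UNIV i \<and>
     (\<forall>c\<in>atlas. \<forall>k. weak_C k linear (i -` fst c) (snd c \<circ> i)) \<and>
     (\<forall>k. C_on k UNIV \<psi>) \<and> (\<forall>p. mink (\<psi> p) (\<psi> p) = 1)"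

definition adapted ::
  "(real^4 \<Rightarrow> real^4) \<Rightarrow> nchart \<Rightarrow> bool" where
  "adapted \<psi> x \<longleftrightarrow> coordinate_system x \<and>
     (\<forall>p\<in>fst x. \<psi> p = coord_field x p 0 \<and> gmat x p $ 0 $ 0 = 1 \<and>
        (\<forall>j. j \<noteq> 0 \<longrightarrow> gmat x p $ 0 $ j = 0))"

text \<open>Pullbacks are computed in some chart around \<open>i p\<close>; connection and curvature being tensorial,
  the choice is immaterial.\<close>

definition chart_at :: "('m, 'a, 'd) qchart set \<Rightarrow> 'm \<Rightarrow> ('m, 'a, 'd) qchart" where
  "chart_at atlas q = (SOME c. c \<in> atlas \<and> q \<in> fst c)"

definition frame_deriv ::
  "('m, 'a::{real_algebra_1, topological_space}, 'd::finite) qchart set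
     \<Rightarrow> (real^4 \<Rightarrow> 'm) \<Rightarrow> real^4 \<Rightarrow> real^4 \<Rightarrow> 'a^'d" where
  "frame_deriv atlas i p X = wderiv (snd (chart_at atlas (i p)) \<circ> i) p X"

definition observed_curvature ::
  "('m, 'a::{real_algebra_1, topological_space}, 'd::finite) qchart set
     \<Rightarrow> ('k \<Rightarrow> 'k \<Rightarrow> 'k \<Rightarrow> 'a) \<Rightarrow> (('m, 'a, 'd) qchart \<Rightarrow> 'm \<Rightarrow> 'a^'d \<Rightarrow> 'a^'k::finite)
     \<Rightarrow> (real^4 \<Rightarrow> 'm) \<Rightarrow> real^4 \<Rightarrow> real^4 \<Rightarrow> real^4 \<Rightarrow> 'a^'k" where
  "observed_curvature atlas C \<mu> i p X Y =
     curvature C \<mu> (chart_at atlas (i p)) (i p) (frame_deriv atlas i p X) (frame_deriv atlas i p Y)"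

definition observed_vierbein ::
  "('m, 'a::{real_algebra_1, topological_space}, 'd::finite) qchart set \<Rightarrow> 'k set
     \<Rightarrow> (('m, 'a, 'd) qchart \<Rightarrow> 'm \<Rightarrow> 'a^'d \<Rightarrow> 'a^'k::finite)
     \<Rightarrow> (real^4 \<Rightarrow> 'm) \<Rightarrow> real^4 \<Rightarrow> real^4 \<Rightarrow> 'a^'k" where
  "observed_vierbein atlas Kv \<mu> i p X =
     summand Kv (\<mu> (chart_at atlas (i p)) (i p) (frame_deriv atlas i p X))"

text \<open>Observed objects from here on: \<open>\<theta> p X\<close> is a vierbein on space-time and \<open>R p X Y\<close> a 2-form on
  space-time, both with values in the columns \<open>'a^'k\<close>.\<close>

definition invertible_vierbein ::
  "'k set \<Rightarrow> (real^4 \<Rightarrow> real^4 \<Rightarrow> 'a::ring_1^'k::finite) \<Rightarrow> bool" where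
  "invertible_vierbein Kv \<theta> \<longleftrightarrow>
     (\<forall>x. coordinate_system x \<longrightarrow> (\<forall>p\<in>fst x.
        \<exists>W. mutually_inverse Kv UNIV (\<lambda>K a. \<theta> p (coord_field x p a) $ K) W))"

definition vierbein_inv ::
  "'k set \<Rightarrow> (real^4 \<Rightarrow> real^4 \<Rightarrow> 'a::ring_1^'k::finite) \<Rightarrow> nchart \<Rightarrow> real^4 \<Rightarrow> 4 \<Rightarrow> 'k \<Rightarrow> 'a" where
  "vierbein_inv Kv \<theta> x p =
     (SOME W. mutually_inverse Kv UNIV (\<lambda>K a. \<theta> p (coord_field x p a) $ K) W)"

text \<open>\<open>torsion Kv \<theta> R x p g a b\<close> stands for \<open>S\<^bsup>g\<^esup>\<^bsub>ab\<^esub>\<close>.\<close>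

definition torsion ::
  "'k set \<Rightarrow> (real^4 \<Rightarrow> real^4 \<Rightarrow> 'a::ring_1^'k::finite) \<Rightarrow> (real^4 \<Rightarrow> real^4 \<Rightarrow> real^4 \<Rightarrow> 'a^'k)
     \<Rightarrow> nchart \<Rightarrow> real^4 \<Rightarrow> 4 \<Rightarrow> 4 \<Rightarrow> 4 \<Rightarrow> 'a" where
  "torsion Kv \<theta> R x p g a b =
     (\<Sum>K\<in>Kv. vierbein_inv Kv \<theta> x p g K * summand Kv (R p (coord_field x p a) (coord_field x p b)) $ K)"

definition spin_structure ::
  "'k set \<Rightarrow> (real^4 \<Rightarrow> real^4 \<Rightarrow> 'a::real_algebra_1^'k::finite)
     \<Rightarrow> (real^4 \<Rightarrow> real^4 \<Rightarrow> real^4 \<Rightarrow> 'a^'k) \<Rightarrow> (real^4 \<Rightarrow> real^4)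
     \<Rightarrow> (real^4 \<Rightarrow> real^4 \<Rightarrow> real^4 \<Rightarrow> 'a) \<Rightarrow> bool" where
  "spin_structure Kv \<theta> R \<psi> s \<longleftrightarrow>
     (\<forall>p X. linear (s p X)) \<and> (\<forall>p X Y. s p X Y = - s p Y X) \<and>
     (\<forall>x. coordinate_system x \<longrightarrow> (\<forall>p\<in>fst x. \<forall>l b.
        (\<forall>a. torsion Kv \<theta> R x p l a b
              = vcomp x p (\<psi> p) l *\<^sub>R s p (coord_field x p a) (coord_field x p b)) \<and>
        (\<Sum>a\<in>UNIV. vcomp x p (\<psi> p) a *\<^sub>R torsion Kv \<theta> R x p l a b) = 0))"

definition spin_vector ::
  "(real^4 \<Rightarrow> real^4) \<Rightarrow> (real^4 \<Rightarrow> real^4 \<Rightarrow> real^4 \<Rightarrow> 'a::real_algebra_1)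
     \<Rightarrow> nchart \<Rightarrow> real^4 \<Rightarrow> 4 \<Rightarrow> 'a" where
  "spin_vector \<psi> s x p r =
     (\<Sum>m\<in>UNIV. \<Sum>n\<in>UNIV. \<Sum>l\<in>UNIV. (eps x p m n l r * vcomp x p (\<psi> p) m) *\<^sub>R
        (\<Sum>a\<in>UNIV. \<Sum>b\<in>UNIV. (metric_inv x p $ n $ a * metric_inv x p $ l $ b) *\<^sub>R
           s p (coord_field x p a) (coord_field x p b)))"

definition raise :: "nchart \<Rightarrow> real^4 \<Rightarrow> (4 \<Rightarrow> 'a::real_vector) \<Rightarrow> 4 \<Rightarrow> 'a" where
  "raise x p \<sigma> k = (\<Sum>j\<in>UNIV. metric_inv x p $ k $ j *\<^sub>R \<sigma> j)"

section \<open>Spectral-spin-classification\<close>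

definition boson_set :: "real \<Rightarrow> real set" where
  "boson_set hbar = {hbar\<^sup>2 * s * (s + 1) | s. s \<in> \<nat>}"

definition fermion_set :: "real \<Rightarrow> real set" where
  "fermion_set hbar = {hbar\<^sup>2 * s * (s + 1) | s. \<exists>n::nat. s = (2 * real n + 1) / 2}"

text \<open>\<open>s = j/2\<close> runs through all integral and half-integral spins and \<open>m = -s + n\<close> through
  \<open>-s, \<dots>, s\<close>.\<close>

definition polar_set :: "real \<Rightarrow> real set" where
  "polar_set hbar = {hbar * (- (real j / 2) + real n) | (j::nat) (n::nat). n \<le> j}"

datatype polarization = Bosonic_Polarized | Fermionic_Polarized | Unpolarized | Mixt_Polarized

text \<open>The classes that apply at \<open>p\<close> to a spin-vector with lower components \<open>\<sigma>\<close> in the coordinates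
  \<open>x\<close>; the \<open>z\<close>-component is the one with index \<open>3\<close>. The classes are not mutually exclusive.\<close>

definition spin_classification ::
  "('f::real_normed_field \<Rightarrow> 'a::real_algebra_1 \<Rightarrow> 'a) \<Rightarrow> real
     \<Rightarrow> nchart \<Rightarrow> real^4 \<Rightarrow> (4 \<Rightarrow> 'a) \<Rightarrow> polarization set" where
  "spin_classification smul hbar x p \<sigma> =
     (let Sq = spectrum smul (\<Sum>r\<in>UNIV. raise x p \<sigma> r * \<sigma> r);
          Sz = spectrum smul (\<sigma> 3);
          b = of_real ` boson_set hbar; f = of_real ` fermion_set hbar; c = of_real ` polar_set hbar
      in {l. case l of
            Bosonic_Polarized \<Rightarrow> Sq \<subseteq> b \<and> Sz \<subseteq> c
          | Fermionic_Polarized \<Rightarrow> Sq \<subseteq> f \<and> Sz \<subseteq> c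
          | Unpolarized \<Rightarrow> Sq \<inter> b = {} \<and> Sq \<inter> f = {}
          | Mixt_Polarized \<Rightarrow> Sq \<inter> b \<noteq> {} \<or> Sq \<inter> f \<noteq> {}})"

end

theory Submission
  imports Defs
begin

text \<open>The observed curvature is a real bilinear alternating form: connection, frame and weak
  derivatives are linear over the reals, and differentiation commutes with the linear dependence of
  the connection on its vector argument. Everything else is linear algebra of a 2-form at a point. In
  positively oriented coordinates \<open>\<epsilon>\<close> is the volume form evaluated on the coordinate fields, and
  contracting a bilinear map with the inverse metric does not depend on the coordinates; together
  these give the coordinate expression of the star. The sign in the relation between \<open>B\<^sub>v\<close> and
  the spin-vector is the sign of the cyclic permutation of the four indices of \<open>\<epsilon>\<close>, and \<open>E\<^sub>v\<close>
  vanishes because the inverse vierbein can be cancelled.\<close>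


section \<open>Weak derivatives\<close>

text \<open>The algebra carries a topology but no norm, so limits of columns are handled entry by
  entry; uniqueness comes from the Hausdorff property of the entries.\<close>

lemma vec_tendsto_unique:
  fixes f :: "'x \<Rightarrow> 'a::t2_space ^ 'n"
  assumes "F \<noteq> bot" "(f \<longlongrightarrow> a) F" "(f \<longlongrightarrow> b) F"
  shows "a = b"
  unfolding vec_eq_iff
  using tendsto_unique[OF assms(1) tendsto_vec_nth[OF assms(2)] tendsto_vec_nth[OF assms(3)]]
  by blast

lemma vec_tendsto_add:
  fixes f g :: "'x \<Rightarrow> 'a::topological_monoid_add ^ 'n"
  assumes "(f \<longlongrightarrow> a) F" "(g \<longlongrightarrow> b) F"
  shows "((\<lambda>x. f x + g x) \<longlongrightarrow> a + b) F"
  by (rule vec_tendstoI) (auto intro!: tendsto_add tendsto_vec_nth assms)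

text \<open>A fixed real factor acts as multiplication by the constant \<open>of_real r\<close>, so
  continuity of the product is enough here.\<close>

lemma vec_tendsto_scaleR:
  fixes f :: "'x \<Rightarrow> 'a::{real_algebra_1, topological_semigroup_mult} ^ 'n"
  assumes "(f \<longlongrightarrow> a) F"
  shows "((\<lambda>x. r *\<^sub>R f x) \<longlongrightarrow> r *\<^sub>R a) F"
  unfolding scaleR_vec_def
  by (rule vec_tendstoI)
    (auto simp: scaleR_conv_of_real intro!: tendsto_mult tendsto_const tendsto_vec_nth assms)

text \<open>\<open>wderiv\<close> is a definite description; its value can be read off from a limit
  because limits in a Hausdorff space are unique.\<close>

lemma wderiv_eqI:
  fixes f :: "'x::real_vector \<Rightarrow> 'a::{real_vector, t2_space} ^ 'n"
  assumes "((\<lambda>t::real. (f (x + t *\<^sub>R v) - f x) /\<^sub>R t) \<longlongrightarrow> l) (at 0)"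
  shows "wderiv f x v = l"
  unfolding wderiv_def
proof (rule the_equality)
  show "((\<lambda>t::real. (f (x + t *\<^sub>R v) - f x) /\<^sub>R t) \<longlongrightarrow> l) (at 0)" by (rule assms)
next
  fix m assume "((\<lambda>t::real. (f (x + t *\<^sub>R v) - f x) /\<^sub>R t) \<longlongrightarrow> m) (at 0)"
  then show "m = l" by (rule vec_tendsto_unique[OF at_neq_bot _ assms])
qed

lemma has_weak_derivative_imp_wderiv:
  fixes f :: "'x::real_vector \<Rightarrow> 'a::{real_vector, t2_space} ^ 'n"
  shows "has_weak_derivative f x D \<Longrightarrow> wderiv f x = D"
  by (rule ext) (simp add: has_weak_derivative_def wderiv_eqI)

section \<open>Linearity over the center implies real linearity\<close>

lemma of_real_in_center: "(of_real r :: 'a::real_algebra_1) \<in> center"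
  by (simp add: center_def of_real_def)

lemma zscale_of_real: "zscale (of_real r) v = r *\<^sub>R (v :: 'a::real_algebra_1 ^ 'n)"
  unfolding zscale_def vec_eq_iff vector_scaleR_component by (simp add: scaleR_conv_of_real)

text \<open>Real multiples of 1 are central, and \<open>zscale\<close> by such an element is
  ordinary real scaling.\<close>

lemma Z_linear_imp_linear:
  fixes f :: "'a::real_algebra_1 ^ 'n \<Rightarrow> 'a ^ 'l"
  assumes "Z_linear f"
  shows "linear f"
proof (rule linearI)
  show "f (v + w) = f v + f w" for v w
    using assms by (simp add: Z_linear_wrt_def)
  show "f (r *\<^sub>R v) = r *\<^sub>R f v" for r v
  proof -
    have "f (zscale (of_real r) v) = zscale (of_real r) (f v)"
      using assms of_real_in_center[of r] unfolding Z_linear_wrt_def by blast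
    then show ?thesis by (simp only: zscale_of_real)
  qed
qed

text \<open>The type classes on the algebra do not make scalar multiplication continuous in the scalar;
  the seminorms do.\<close>

context quantum_superalgebra
begin

lemma scaleR_tendsto_zero: "((\<lambda>t::real. t *\<^sub>R (a :: 'a)) \<longlongrightarrow> 0) (at 0)"
proof -
  obtain sn :: "nat \<Rightarrow> 'a \<Rightarrow> real" where
    sc: "\<forall>n c a. sn n (smul c a) = norm c * sn n a" and
    op: "\<forall>S. open S \<longleftrightarrow> (\<forall>a\<in>S. \<exists>n. \<exists>e>0. {b. \<forall>j\<le>n. sn j (b - a) < e} \<subseteq> S)"
    using frechet by (elim exE conjE) blast
  have sn: "sn j (t *\<^sub>R a) = \<bar>t\<bar> * sn j a" for j t
    using sc[rule_format, of j "of_real t" a] by (simp add: scale_of_real)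
  show ?thesis
  proof (rule topological_tendstoI)
    fix S :: "'a set" assume "open S" "0 \<in> S"
    then obtain n e where e: "e > 0" and S: "{b. \<forall>j\<le>n. sn j (b - 0) < e} \<subseteq> S"
      using op by blast
    \<comment> \<open>A basic neighbourhood of 0 restricts only finitely many seminorms, so the
      conditions on \<open>t\<close> can be met simultaneously.\<close>
    have "\<forall>\<^sub>F t in at 0. \<forall>j\<in>{..n}. \<bar>t\<bar> * sn j a < e"
    proof (rule eventually_ball_finite, simp, rule ballI)
      fix j
      have "((\<lambda>t::real. \<bar>t\<bar> * sn j a) \<longlongrightarrow> \<bar>0\<bar> * sn j a) (at 0)"
        by (intro tendsto_intros)
      then show "\<forall>\<^sub>F t in at 0. \<bar>t\<bar> * sn j a < e"
        using e by (auto dest: order_tendstoD)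
    qed
    then show "\<forall>\<^sub>F t in at 0. t *\<^sub>R a \<in> S"
      by (rule eventually_mono) (use S sn in auto)
  qed
qed

text \<open>Identities between representatives of the connection hold only on the image of a chart.
  They pass to difference quotients because the line stays in that open set for small
  \<open>t\<close>.\<close>

lemma eventually_line_in_open:
  fixes x v :: "'a ^ 'd"
  assumes "open U" "x \<in> U"
  shows "\<forall>\<^sub>F t::real in at 0. x + t *\<^sub>R v \<in> U"
proof -
  have "((\<lambda>t::real. x + t *\<^sub>R v) \<longlongrightarrow> x) (at 0)"
  proof (rule vec_tendstoI)
    fix j
    have "((\<lambda>t::real. x $ j + t *\<^sub>R v $ j) \<longlongrightarrow> x $ j + 0) (at 0)"
      by (intro tendsto_add tendsto_const scaleR_tendsto_zero)
    then show "((\<lambda>t::real. (x + t *\<^sub>R v) $ j) \<longlongrightarrow> x $ j) (at 0)" by simp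
  qed
  then show ?thesis using assms by (rule topological_tendstoD)
qed

text \<open>The difference quotients of \<open>h\<close> are eventually the sums of those of
  \<open>f\<close> and \<open>g\<close>, hence have the same limit.\<close>

lemma wderiv_add:
  fixes f g h :: "'a ^ 'd \<Rightarrow> 'a ^ 'k"
  assumes "has_weak_derivative f x Df" "has_weak_derivative g x Dg"
    and U: "open U" "x \<in> U" and eq: "\<And>y. y \<in> U \<Longrightarrow> h y = f y + g y"
  shows "wderiv h x v = Df v + Dg v"
proof (rule wderiv_eqI)
  have "((\<lambda>t::real. (f (x + t *\<^sub>R v) - f x) /\<^sub>R t + (g (x + t *\<^sub>R v) - g x) /\<^sub>R t)
      \<longlongrightarrow> Df v + Dg v) (at 0)"
    using assms(1,2) by (intro vec_tendsto_add) (auto simp: has_weak_derivative_def)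
  moreover have "\<forall>\<^sub>F t::real in at 0. (f (x + t *\<^sub>R v) - f x) /\<^sub>R t + (g (x + t *\<^sub>R v) - g x) /\<^sub>R t
      = (h (x + t *\<^sub>R v) - h x) /\<^sub>R t"
    using eventually_line_in_open[OF U, of v]
    by (rule eventually_mono) (simp add: eq U(2) algebra_simps)
  ultimately show "((\<lambda>t::real. (h (x + t *\<^sub>R v) - h x) /\<^sub>R t) \<longlongrightarrow> Df v + Dg v) (at 0)"
    by (rule Lim_transform_eventually)
qed

lemma wderiv_scaleR:
  fixes f h :: "'a ^ 'd \<Rightarrow> 'a ^ 'k"
  assumes "has_weak_derivative f x Df"
    and U: "open U" "x \<in> U" and eq: "\<And>y. y \<in> U \<Longrightarrow> h y = r *\<^sub>R f y"
  shows "wderiv h x v = r *\<^sub>R Df v"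
proof (rule wderiv_eqI)
  have "((\<lambda>t::real. r *\<^sub>R ((f (x + t *\<^sub>R v) - f x) /\<^sub>R t)) \<longlongrightarrow> r *\<^sub>R Df v) (at 0)"
    using assms(1) by (intro vec_tendsto_scaleR) (auto simp: has_weak_derivative_def)
  moreover have "\<forall>\<^sub>F t::real in at 0. r *\<^sub>R ((f (x + t *\<^sub>R v) - f x) /\<^sub>R t)
      = (h (x + t *\<^sub>R v) - h x) /\<^sub>R t"
    using eventually_line_in_open[OF U, of v]
    by (rule eventually_mono) (simp add: eq U(2) algebra_simps)
  ultimately show "((\<lambda>t::real. (h (x + t *\<^sub>R v) - h x) /\<^sub>R t) \<longlongrightarrow> r *\<^sub>R Df v) (at 0)"
    by (rule Lim_transform_eventually)
qed

end

section \<open>The observed curvature is a 2-form\<close>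

lemma bracket_add_left: "bracket C (X + X') Y = bracket C X Y + bracket C X' Y"
  by (simp add: bracket_def acomm_def vec_eq_iff algebra_simps sum.distrib)

lemma bracket_add_right: "bracket C X (Y + Y') = bracket C X Y + bracket C X Y'"
  by (simp add: bracket_def acomm_def vec_eq_iff algebra_simps sum.distrib)

lemma bracket_scaleR_left: "bracket C (r *\<^sub>R X) Y = r *\<^sub>R bracket C X Y"
  by (simp add: bracket_def acomm_def vec_eq_iff scaleR_sum_right algebra_simps)

lemma bracket_scaleR_right: "bracket C X (r *\<^sub>R Y) = r *\<^sub>R bracket C X Y"
  by (simp add: bracket_def acomm_def vec_eq_iff scaleR_sum_right algebra_simps)

text \<open>The defining expression is antisymmetrized in \<open>v\<close> and \<open>w\<close>,
  both in the derivative terms and in the brackets.\<close>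

lemma curvature_swap: "curvature C \<mu> c q v w = - curvature C \<mu> c q w v"
  by (simp add: curvature_def algebra_simps)

context quantum_superalgebra
begin

text \<open>The vector \<open>v\<close> enters the two derivative terms differently: once as the
  direction of differentiation, where linearity belongs to the smoothness class, and once as a
  parameter of the differentiated map, where linearity of the connection must be carried through the
  limit.\<close>

lemma curvature_linear_left:
  fixes atlas :: "('m::t2_space, 'a, 'd::finite) qchart set"
    and \<mu> :: "('m, 'a, 'd) qchart \<Rightarrow> 'm \<Rightarrow> 'a^'d \<Rightarrow> 'a^'k::finite"
  assumes M: "quantum_supermanifold atlas" and con: "quantum_connection atlas \<mu>"
    and c: "c \<in> atlas" "q \<in> fst c"
  shows "linear (\<lambda>v. curvature C \<mu> c q v w)"
proof -
  define U where "U = snd c ` fst c"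
  define x where "x = snd c q"
  define f where "f w y = \<mu> c (chart_inv c y) w" for w y
  have U: "open U" "x \<in> U" using M c by (auto simp: quantum_supermanifold_def U_def x_def)
  have inv: "chart_inv c y \<in> fst c" if "y \<in> U" for y
    using that by (auto simp: U_def chart_inv_def intro: inv_into_into)
  have \<mu>: "linear (\<mu> c r)" if "r \<in> fst c" for r
    using con c that by (intro Z_linear_imp_linear) (auto simp: quantum_connection_def)
  \<comment> \<open>Order one of the smoothness class already supplies a derivative that is linear
    over the center.\<close>
  have "\<exists>D. Z_linear D \<and> has_weak_derivative (f w) x D" for w
  proof -
    have "weak_C (Suc 0) Z_linear U (f w)"
      using con c(1) unfolding quantum_connection_def U_def f_def by blast
    then show ?thesis using U(2) by auto
  qed
  then obtain D where D: "\<And>w. Z_linear (D w)" "\<And>w. has_weak_derivative (f w) x (D w)" by metis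
  have cd: "chart_deriv c (\<lambda>r. \<mu> c r w) q v = D w v" for v w
  proof -
    have "(\<lambda>r. \<mu> c r w) \<circ> chart_inv c = f w" by (auto simp: f_def)
    then show ?thesis
      using has_weak_derivative_imp_wderiv[OF D(2)[of w]] by (simp add: chart_deriv_def x_def)
  qed
  have lin: "linear (D w)" for w using D(1) by (rule Z_linear_imp_linear)
  \<comment> \<open>This is additivity in the parameter, not in the direction: it holds because
    \<open>f (v + v')\<close> and \<open>f v + f v'\<close> agree on the chart image.\<close>
  have add: "D (v + v') w = D v w + D v' w" for v v' w
  proof -
    have "D (v + v') w = wderiv (f (v + v')) x w"
      using has_weak_derivative_imp_wderiv[OF D(2)] by simp
    also have "\<dots> = D v w + D v' w"
      by (rule wderiv_add[OF D(2) D(2) U]) (simp add: f_def linear_add[OF \<mu>[OF inv]])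
    finally show ?thesis .
  qed
  have scale: "D (r *\<^sub>R v) w = r *\<^sub>R D v w" for r v w
  proof -
    have "D (r *\<^sub>R v) w = wderiv (f (r *\<^sub>R v)) x w"
      using has_weak_derivative_imp_wderiv[OF D(2)] by simp
    also have "\<dots> = r *\<^sub>R D v w"
      by (rule wderiv_scaleR[OF D(2) U]) (simp add: f_def linear_scale[OF \<mu>[OF inv]])
    finally show ?thesis .
  qed
  note m = \<mu>[OF c(2)]
  show ?thesis
  proof (rule linearI)
    show "curvature C \<mu> c q (v + v') w = curvature C \<mu> c q v w + curvature C \<mu> c q v' w" for v v'
      unfolding curvature_def cd
      by (simp add: add linear_add[OF lin] linear_add[OF m] bracket_add_left bracket_add_right
          algebra_simps)
    show "curvature C \<mu> c q (r *\<^sub>R v) w = r *\<^sub>R curvature C \<mu> c q v w" for r v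
      unfolding curvature_def cd
      by (simp add: scale linear_scale[OF lin] linear_scale[OF m] bracket_scaleR_left
          bracket_scaleR_right algebra_simps)
  qed
qed

end

lemma chart_at_props:
  assumes "quantum_supermanifold atlas"
  shows "chart_at atlas q \<in> atlas" "q \<in> fst (chart_at atlas q)"
proof -
  have "\<exists>c. c \<in> atlas \<and> q \<in> fst c" using assms unfolding quantum_supermanifold_def by blast
  then have "chart_at atlas q \<in> atlas \<and> q \<in> fst (chart_at atlas q)"
    unfolding chart_at_def by (rule someI_ex)
  then show "chart_at atlas q \<in> atlas" "q \<in> fst (chart_at atlas q)" by auto
qed

text \<open>A Gateaux derivative need not be linear; linearity is part of the class in
  \<open>relativistic_frame\<close>, and uniqueness of limits identifies \<open>wderiv\<close> with
  the derivative provided there.\<close>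

lemma linear_frame_deriv:
  fixes atlas :: "('m::t2_space, 'a::{real_algebra_1, t2_space}, 'd::finite) qchart set"
  assumes "quantum_supermanifold atlas" "relativistic_frame atlas i \<psi>"
  shows "linear (frame_deriv atlas i p)"
proof -
  let ?c = "chart_at atlas (i p)"
  note c = chart_at_props[OF assms(1), of "i p"]
  have "weak_C (Suc 0) linear (i -` fst ?c) (snd ?c \<circ> i)"
    using assms(2) c(1) unfolding relativistic_frame_def by blast
  then obtain D where "linear D" "has_weak_derivative (snd ?c \<circ> i) p D"
    using c(2) by auto
  moreover have "frame_deriv atlas i p = wderiv (snd ?c \<circ> i) p"
    by (rule ext) (simp add: frame_deriv_def)
  ultimately show ?thesis by (simp add: has_weak_derivative_imp_wderiv)
qed

lemma observed_curvature_swap: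
  "observed_curvature atlas C \<mu> i p X Y = - observed_curvature atlas C \<mu> i p Y X"
  unfolding observed_curvature_def by (rule curvature_swap)

lemma (in quantum_superalgebra) linear_observed_curvature:
  fixes atlas :: "('m::t2_space, 'a, 'd::finite) qchart set"
    and \<mu> :: "('m, 'a, 'd) qchart \<Rightarrow> 'm \<Rightarrow> 'a^'d \<Rightarrow> 'a^'k::finite"
  assumes M: "quantum_supermanifold atlas" and con: "quantum_connection atlas \<mu>"
    and fr: "relativistic_frame atlas i \<psi>"
  shows "linear (\<lambda>X. observed_curvature atlas C \<mu> i p X Y)"
  unfolding observed_curvature_def
  using linear_compose[OF linear_frame_deriv[OF M fr]
      curvature_linear_left[OF M con chart_at_props[OF M]]]
  by (simp add: comp_def)


section \<open>The volume form\<close>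

text \<open>In the index type \<open>4\<close> the numeral 4 equals 0, so the four indices can be
  listed with the time index 0 first.\<close>

lemma UNIV_4_from_0: "(UNIV :: 4 set) = {0, 1, 2, 3}"
proof -
  have "(4 :: 4) = 0" by simp
  then have "(UNIV :: 4 set) = {1, 2, 3, 0}" by (simp only: UNIV_4)
  then show ?thesis by (simp only: insert_commute)
qed

lemma cases_4: "i = 0 \<or> i = 1 \<or> i = 2 \<or> i = 3" for i :: 4
proof -
  have "i \<in> {0, 1, 2, 3}" by (simp only: UNIV_4_from_0[symmetric] UNIV_I)
  then show ?thesis by simp
qed

lemma sum_UNIV_4: "(\<Sum>j\<in>(UNIV :: 4 set). f j) = f 0 + (\<Sum>j\<in>{1, 2, 3}. f j :: 'y::comm_monoid_add)"
  unfolding UNIV_4_from_0 by (subst sum.insert) auto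

lemma linear_det_row:
  fixes c :: "'n::finite \<Rightarrow> real ^ 'n"
  shows "linear (\<lambda>a. det (\<chi> i. if i = k then a else c i))"
proof (rule linearI)
  show "det (\<chi> i. if i = k then a + b else c i)
      = det (\<chi> i. if i = k then a else c i) + det (\<chi> i. if i = k then b else c i)" for a b
    using det_row_add[of k "\<lambda>_. a" "\<lambda>_. b" c] by simp
  show "det (\<chi> i. if i = k then r *\<^sub>R a else c i) = r *\<^sub>R det (\<chi> i. if i = k then a else c i)" for r a
    using det_row_mul[of k r "\<lambda>_. a" c] by (simp add: scalar_mult_eq_scaleR cong: if_cong)
qed

lemma linear_vol4_1: "linear (\<lambda>a. vol4 a b c d)"
  unfolding vol4_def by (rule linear_det_row)

text \<open>\<open>linear_det_row\<close> expects the varying row in the first branch of the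
  conditional. The tests exclude one another, so they may be reordered; the next two lemmas do the
  same.\<close>

lemma linear_vol4_2: "linear (\<lambda>b. vol4 a b c d)"
proof -
  have "(\<chi> i::4. if i = 0 then a else if i = 1 then b else if i = 2 then c else d)
      = (\<chi> i. if i = 1 then b else if i = 0 then a else if i = 2 then c else d)" for b
    by (auto simp: vec_eq_iff)
  then show ?thesis unfolding vol4_def by (simp only: linear_det_row)
qed

lemma linear_vol4_3: "linear (\<lambda>c. vol4 a b c d)"
proof -
  have "(\<chi> i::4. if i = 0 then a else if i = 1 then b else if i = 2 then c else d)
      = (\<chi> i. if i = 2 then c else if i = 0 then a else if i = 1 then b else d)" for c
    by (auto simp: vec_eq_iff)
  then show ?thesis unfolding vol4_def by (simp only: linear_det_row)
qed

lemma linear_vol4_4: "linear (\<lambda>d. vol4 a b c d)"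
proof -
  \<comment> \<open>Row 3 is the default branch of \<open>vol4\<close>; exhausting the index type
    turns it into an explicit test.\<close>
  have "(\<chi> i::4. if i = 0 then a else if i = 1 then b else if i = 2 then c else d)
      = (\<chi> i. if i = 3 then d else if i = 0 then a else if i = 1 then b else c)" for d
    using cases_4 by (simp add: vec_eq_iff) metis
  then show ?thesis unfolding vol4_def by (simp only: linear_det_row)
qed

lemma vol4_eq_zero: "vol4 a a c d = 0" "vol4 a b b d = 0" "vol4 a b c c = 0" "vol4 a b c a = 0"
  unfolding vol4_def
  by (rule det_identical_rows[of 0 1] det_identical_rows[of 1 2] det_identical_rows[of 2 3]
      det_identical_rows[of 0 3]; simp add: row_def)+

text \<open>Polarization: expand the vanishing value \<open>f (x + y) (x + y)\<close>.\<close>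

lemma alternating_imp_antisymmetric:
  fixes f :: "'x::real_vector \<Rightarrow> 'x \<Rightarrow> 'y::real_vector"
  assumes "\<And>y. linear (\<lambda>x. f x y)" "\<And>x. linear (f x)" "\<And>x. f x x = 0"
  shows "f x y = - f y x"
proof -
  have "f (x + y) (x + y) = f x x + f x y + (f y x + f y y)"
    by (simp only: linear_add[OF assms(1)] linear_add[OF assms(2)] ac_simps)
  then show ?thesis by (simp add: assms(3) eq_neg_iff_add_eq_0)
qed

lemma vol4_swap_12: "vol4 a b c d = - vol4 b a c d"
  by (rule alternating_imp_antisymmetric[where f = "\<lambda>a b. vol4 a b c d"])
    (simp_all add: linear_vol4_1 linear_vol4_2 vol4_eq_zero)

lemma vol4_swap_23: "vol4 a b c d = - vol4 a c b d"
  by (rule alternating_imp_antisymmetric[where f = "\<lambda>b c. vol4 a b c d"])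
    (simp_all add: linear_vol4_2 linear_vol4_3 vol4_eq_zero)

lemma vol4_swap_34: "vol4 a b c d = - vol4 a b d c"
  by (rule alternating_imp_antisymmetric[where f = "\<lambda>c d. vol4 a b c d"])
    (simp_all add: linear_vol4_3 linear_vol4_4 vol4_eq_zero)

text \<open>A cycle of length four is a product of three transpositions, hence odd.\<close>

lemma vol4_rotate: "vol4 a b c d = - vol4 d a b c"
  using vol4_swap_34[of a b c d] vol4_swap_23[of a b d c] vol4_swap_12[of a d b c] by linarith

text \<open>The vectors are the rows of the matrix in \<open>vol4\<close>, so applying
  \<open>J\<close> to each of them is right multiplication by \<open>transpose J\<close>.\<close>

lemma vol4_matrix_vector_mult:
  "vol4 (J *v a) (J *v b) (J *v c) (J *v d) = det J * vol4 a b c d"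
proof -
  have "(\<chi> i::4. if i = 0 then J *v a else if i = 1 then J *v b else if i = 2 then J *v c else J *v d)
      = (\<chi> i. if i = 0 then a else if i = 1 then b else if i = 2 then c else d) ** transpose J"
    by (auto simp: vec_eq_iff matrix_matrix_mult_def matrix_vector_mult_def transpose_def mult.commute)
  then show ?thesis by (simp add: vol4_def det_mul)
qed

lemma vol4_axis: "vol4 (axis 0 1) (axis 1 1) (axis 2 1) (axis 3 1) = 1"
proof -
  have "(\<chi> i::4. if i = 0 then axis 0 1 else if i = 1 then axis 1 1 else if i = 2 then axis 2 1
      else axis 3 1) = (mat 1 :: real^4^4)"
    using cases_4 by (simp add: vec_eq_iff mat_def axis_def) metis
  then show ?thesis by (simp add: vol4_def)
qed

section \<open>Coordinates on space-time\<close>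

lemma C_on_id: "C_on k U (id :: 'x::euclidean_space \<Rightarrow> 'x)"
proof -
  have const: "C_on k U (\<lambda>_. c :: 'x)" for k c
    by (induction k arbitrary: c) simp_all
  show ?thesis by (cases k) (simp_all add: const differentiableI[OF has_derivative_id])
qed

text \<open>The inertial coordinates form a global chart, through which coordinate hypotheses yield
  statements free of coordinates.\<close>

lemma coordinate_system_id: "coordinate_system (UNIV, id)"
proof -
  have inv: "inv_into UNIV id = (id :: real^4 \<Rightarrow> real^4)" by (rule inv_id)
  show ?thesis
    by (simp add: coordinate_system_def coord_field_def inv C_on_id vol4_axis)
qed

lemma coordinate_derivatives:
  assumes "coordinate_system x" "p \<in> fst x"
  shows "(snd x has_derivative frechet_derivative (snd x) (at p)) (at p)"
    and "(inv_into (fst x) (snd x) has_derivative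
           frechet_derivative (inv_into (fst x) (snd x)) (at (snd x p))) (at (snd x p))"
proof -
  have "C_on (Suc 0) (fst x) (snd x)" "C_on (Suc 0) (snd x ` fst x) (inv_into (fst x) (snd x))"
    using assms(1) unfolding coordinate_system_def by blast+
  then show "(snd x has_derivative frechet_derivative (snd x) (at p)) (at p)"
    "(inv_into (fst x) (snd x) has_derivative
           frechet_derivative (inv_into (fst x) (snd x)) (at (snd x p))) (at (snd x p))"
    using assms(2) by (auto simp: frechet_derivative_works[symmetric])
qed

lemma eta_sym: "eta i j = eta j i"
  by (auto simp: eta_def)

text \<open>The Minkowski matrix is its own inverse, so \<open>eta\<close> serves both as metric and
  as inverse metric in inertial coordinates.\<close>

lemma eta_square: "(\<chi> i j. eta i j) ** (\<chi> i j. eta i j) = (mat 1 :: real^4^4)"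
proof -
  have "(\<Sum>k\<in>UNIV. eta i k * eta k j) = (if i = j then 1 else 0)" for i j
  proof -
    have "(\<Sum>k\<in>UNIV. eta i k * eta k j) = (\<Sum>k\<in>UNIV. if k = i then eta i i * eta i j else 0)"
      by (intro sum.cong) (auto simp: eta_def)
    then show ?thesis by (simp add: eta_def)
  qed
  then show ?thesis by (simp add: vec_eq_iff matrix_matrix_mult_def mat_def)
qed

context
  fixes x :: nchart and p :: "real^4"
  assumes coords: "coordinate_system x" and p: "p \<in> fst x"
begin

text \<open>Chain rule for the chart after its inverse, which is the identity on an open set. With
  the composition in the other order, used next, this makes \<open>vcomp\<close> the dual basis of
  the coordinate fields.\<close>

lemma vcomp_coord_field: "vcomp x p (coord_field x p b) a = (if a = b then 1 else 0)"
proof -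
  let ?f = "snd x" and ?g = "inv_into (fst x) (snd x)"
  have inj: "inj_on ?f (fst x)" and op: "open (?f ` fst x)"
    using coords by (auto simp: coordinate_system_def)
  have gp: "?g (?f p) = p" using inj p by simp
  have "(?f \<circ> ?g has_derivative
      frechet_derivative ?f (at p) \<circ> frechet_derivative ?g (at (?f p))) (at (?f p))"
    using coordinate_derivatives[OF coords p] by (intro diff_chain_at) (simp_all add: gp)
  then have "(id has_derivative
      frechet_derivative ?f (at p) \<circ> frechet_derivative ?g (at (?f p))) (at (?f p))"
    by (rule has_derivative_transform_within_open[OF _ op]) (use p in \<open>auto simp: f_inv_into_f\<close>)
  then have "frechet_derivative ?f (at p) \<circ> frechet_derivative ?g (at (?f p)) = id"
    using has_derivative_id by (rule has_derivative_unique)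
  then have "frechet_derivative ?f (at p) (coord_field x p b) = axis b 1"
    by (simp add: coord_field_def fun_eq_iff)
  then show ?thesis by (simp add: vcomp_def axis_def)
qed

lemma coord_field_expansion: "(\<Sum>a\<in>UNIV. vcomp x p X a *\<^sub>R coord_field x p a) = X"
proof -
  let ?f = "snd x" and ?g = "inv_into (fst x) (snd x)"
  have inj: "inj_on ?f (fst x)" and op: "open (fst x)"
    using coords by (auto simp: coordinate_system_def)
  let ?Df = "frechet_derivative ?f (at p)" and ?Dg = "frechet_derivative ?g (at (?f p))"
  have "(?g \<circ> ?f has_derivative ?Dg \<circ> ?Df) (at p)"
    using coordinate_derivatives[OF coords p] by (intro diff_chain_at)
  then have "(id has_derivative ?Dg \<circ> ?Df) (at p)"
    by (rule has_derivative_transform_within_open[OF _ op p]) (use inj in auto)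
  then have id: "?Dg \<circ> ?Df = id"
    using has_derivative_id by (rule has_derivative_unique)
  have lin: "linear ?Dg"
    using coordinate_derivatives(2)[OF coords p] by (rule has_derivative_linear)
  have "(\<Sum>a\<in>UNIV. vcomp x p X a *\<^sub>R coord_field x p a) = ?Dg (\<Sum>a\<in>UNIV. ?Df X $ a *s axis a 1)"
    by (simp add: vcomp_def coord_field_def linear_sum[OF lin] linear_scale[OF lin]
        scalar_mult_eq_scaleR)
  also have "\<dots> = ?Dg (?Df X)" by (simp only: basis_expansion)
  also have "\<dots> = X" using id by (simp add: fun_eq_iff)
  finally show ?thesis .
qed

lemma linear_eq_coord_sum:
  assumes "linear f"
  shows "f X = (\<Sum>a\<in>UNIV. vcomp x p X a *\<^sub>R f (coord_field x p a))"
proof -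
  have "f X = f (\<Sum>a\<in>UNIV. vcomp x p X a *\<^sub>R coord_field x p a)"
    by (simp only: coord_field_expansion)
  then show ?thesis by (simp add: linear_sum[OF assms] linear_scale[OF assms])
qed

section \<open>Jacobian matrix, inverse metric and volume in coordinates\<close>

definition jacobian :: "real^4^4" where
  "jacobian = (\<chi> i a. coord_field x p a $ i)"

definition jacobian_inv :: "real^4^4" where
  "jacobian_inv = (\<chi> a i. vcomp x p (axis i 1) a)"

lemma jacobian_axis: "jacobian *v axis a 1 = coord_field x p a"
  by (simp add: jacobian_def matrix_vector_mult_basis column_def vec_eq_iff)

text \<open>One product is the coordinate expansion of the inertial basis vectors, read entry by
  entry; the other follows because the matrices are square.\<close>

lemma jacobian_inverse: "jacobian ** jacobian_inv = mat 1" "jacobian_inv ** jacobian = mat 1"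
proof -
  show *: "jacobian ** jacobian_inv = mat 1"
  proof -
    have "(\<Sum>a\<in>UNIV. coord_field x p a $ i * vcomp x p (axis j 1) a) = axis j 1 $ i" for i j
      using arg_cong[OF coord_field_expansion[of "axis j 1"], of "\<lambda>v. v $ i"]
      by (simp add: mult.commute)
    then show ?thesis
      by (simp add: vec_eq_iff matrix_matrix_mult_def jacobian_def jacobian_inv_def mat_def axis_def)
  qed
  show "jacobian_inv ** jacobian = mat 1" using * by (simp add: matrix_left_right_inverse)
qed

lemma gmat_eq: "gmat x p = transpose jacobian ** (\<chi> i j. eta i j) ** jacobian"
proof -
  have "mink v w = (\<Sum>j\<in>UNIV. (\<Sum>i\<in>UNIV. v $ i * eta i j) * w $ j)" for v w
    unfolding mink_def by (subst sum.swap) (simp add: sum_distrib_right sum_distrib_left ac_simps)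
  then show ?thesis
    by (simp add: vec_eq_iff gmat_def matrix_matrix_mult_def jacobian_def transpose_def)
qed

lemma gmat_metric_inv: "gmat x p ** metric_inv x p = mat 1"
  and metric_inv_eq: "metric_inv x p = jacobian_inv ** (\<chi> i j. eta i j) ** transpose jacobian_inv"
proof -
  let ?N = "(\<chi> i j. eta i j) :: real^4^4"
  let ?H = "jacobian_inv ** ?N ** transpose jacobian_inv"
  have "gmat x p ** ?H
      = transpose jacobian ** ?N ** (jacobian ** jacobian_inv) ** ?N ** transpose jacobian_inv"
    by (simp add: gmat_eq matrix_mul_assoc)
  also have "\<dots> = transpose jacobian ** (?N ** ?N) ** transpose jacobian_inv"
    by (simp add: jacobian_inverse matrix_mul_assoc)
  also have "\<dots> = transpose (jacobian_inv ** jacobian)"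
    by (simp add: eta_square matrix_transpose_mul)
  also have "\<dots> = mat 1" by (simp add: jacobian_inverse)
  finally have r: "gmat x p ** ?H = mat 1" .
  then have l: "?H ** gmat x p = mat 1" by (simp add: matrix_left_right_inverse)
  \<comment> \<open>\<open>matrix_inv\<close> chooses some two-sided inverse; \<open>?H\<close>
    shows that one exists, and the uniqueness of inverses then makes the choice equal to
    \<open>?H\<close>.\<close>
  have "gmat x p ** metric_inv x p = mat 1 \<and> metric_inv x p ** gmat x p = mat 1"
    unfolding metric_inv_def matrix_inv_def by (rule someI[of _ ?H]) (use r l in blast)
  then show i: "gmat x p ** metric_inv x p = mat 1" by blast
  have "metric_inv x p = (?H ** gmat x p) ** metric_inv x p" by (simp add: l)
  also have "\<dots> = ?H" by (simp add: matrix_mul_assoc[symmetric] i)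
  finally show "metric_inv x p = ?H" .
qed

lemma metric_inv_component:
  "metric_inv x p $ a $ b
    = (\<Sum>i\<in>UNIV. \<Sum>j\<in>UNIV. eta i j * vcomp x p (axis i 1) a * vcomp x p (axis j 1) b)"
  unfolding metric_inv_eq
  by (subst sum.swap) (simp add: matrix_matrix_mult_def jacobian_inv_def transpose_def
      sum_distrib_right sum_distrib_left ac_simps)

lemma metric_inv_sym: "metric_inv x p $ a $ b = metric_inv x p $ b $ a"
  unfolding metric_inv_component
  by (subst sum.swap) (simp add: eta_sym ac_simps)

text \<open>Both sides contract \<open>f\<close> with the inverse metric, in inertial coordinates on
  the left. Expanding the inertial basis in coordinate fields leaves exactly the transformation law
  of \<open>metric_inv_component\<close>.\<close>

lemma metric_trace:
  fixes f :: "real^4 \<Rightarrow> real^4 \<Rightarrow> 'y::real_vector"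
  assumes f: "\<And>v. linear (\<lambda>u. f u v)" "\<And>u. linear (f u)"
  shows "(\<Sum>i\<in>UNIV. \<Sum>j\<in>UNIV. eta i j *\<^sub>R f (axis i 1) (axis j 1))
    = (\<Sum>a\<in>UNIV. \<Sum>b\<in>UNIV. metric_inv x p $ a $ b *\<^sub>R f (coord_field x p a) (coord_field x p b))"
proof -
  let ?w = "\<lambda>i a. vcomp x p (axis i 1) a"
  let ?F = "\<lambda>a b. f (coord_field x p a) (coord_field x p b)"
  have "f (axis i 1) (axis j 1) = (\<Sum>a\<in>UNIV. \<Sum>b\<in>UNIV. (?w i a * ?w j b) *\<^sub>R ?F a b)" for i j
    by (subst linear_eq_coord_sum[OF f(1)], subst linear_eq_coord_sum[OF f(2)])
      (simp add: scaleR_sum_right)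
  then have "(\<Sum>i\<in>UNIV. \<Sum>j\<in>UNIV. eta i j *\<^sub>R f (axis i 1) (axis j 1))
      = (\<Sum>i\<in>UNIV. \<Sum>j\<in>UNIV. \<Sum>a\<in>UNIV. \<Sum>b\<in>UNIV. (eta i j * ?w i a * ?w j b) *\<^sub>R ?F a b)"
    by (simp add: scaleR_sum_right mult.assoc)
  \<comment> \<open>The exchanges move the inertial indices \<open>i\<close> and \<open>j\<close> to
    the inside, where their sum is an entry of the inverse metric.\<close>
  also have "\<dots> = (\<Sum>i\<in>UNIV. \<Sum>a\<in>UNIV. \<Sum>j\<in>UNIV. \<Sum>b\<in>UNIV. (eta i j * ?w i a * ?w j b) *\<^sub>R ?F a b)"
    by (intro sum.cong refl sum.swap)
  also have "\<dots> = (\<Sum>i\<in>UNIV. \<Sum>a\<in>UNIV. \<Sum>b\<in>UNIV. \<Sum>j\<in>UNIV. (eta i j * ?w i a * ?w j b) *\<^sub>R ?F a b)"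
    by (intro sum.cong refl sum.swap)
  also have "\<dots> = (\<Sum>a\<in>UNIV. \<Sum>i\<in>UNIV. \<Sum>b\<in>UNIV. \<Sum>j\<in>UNIV. (eta i j * ?w i a * ?w j b) *\<^sub>R ?F a b)"
    by (rule sum.swap)
  also have "\<dots> = (\<Sum>a\<in>UNIV. \<Sum>b\<in>UNIV. \<Sum>i\<in>UNIV. \<Sum>j\<in>UNIV. (eta i j * ?w i a * ?w j b) *\<^sub>R ?F a b)"
    by (intro sum.cong refl sum.swap)
  also have "\<dots> = (\<Sum>a\<in>UNIV. \<Sum>b\<in>UNIV. metric_inv x p $ a $ b *\<^sub>R ?F a b)"
    by (simp add: metric_inv_component scaleR_sum_left)
  finally show ?thesis .
qed

text \<open>The determinant of the metric is minus the square of the Jacobian determinant. Positive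
  orientation makes its root the Jacobian determinant itself, without a sign.\<close>

lemma eps_eq_vol4:
  "eps x p m n l r = vol4 (coord_field x p m) (coord_field x p n) (coord_field x p l) (coord_field x p r)"
proof -
  have vol: "vol4 (coord_field x p m) (coord_field x p n) (coord_field x p l) (coord_field x p r)
      = det jacobian * delta0123 m n l r" for m n l r
    unfolding delta0123_def jacobian_axis[symmetric] by (rule vol4_matrix_vector_mult)
  have pos: "det jacobian > 0"
    using coords p vol[of 0 1 2 3] by (auto simp: coordinate_system_def delta0123_def vol4_axis)
  have "det ((\<chi> i j. eta i j) :: real^4^4) = (\<Prod>i\<in>UNIV. eta i i)"
    by (subst det_diagonal) (simp_all add: eta_def)
  also have "\<dots> = -1" unfolding UNIV_4_from_0 by (simp add: eta_def)
  finally have "det (gmat x p) = - (det jacobian)\<^sup>2"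
    by (simp add: gmat_eq det_mul power2_eq_square)
  then have "sqrt \<bar>det (gmat x p)\<bar> = det jacobian" using pos by simp
  then show ?thesis by (simp add: eps_def vol)
qed

end


section \<open>Contractions of a 2-form and of its star\<close>

text \<open>Isolates the pointwise algebra of the observed curvature; with values in an arbitrary
  real vector space. Linearity in the second argument is derived from antisymmetry.\<close>

locale two_form =
  fixes \<omega> :: "real^4 \<Rightarrow> real^4 \<Rightarrow> real^4 \<Rightarrow> 'y::real_vector"
  assumes linear_left: "linear (\<lambda>X. \<omega> p X Y)"
    and antisymmetric: "\<omega> p X Y = - \<omega> p Y X"
begin

lemma linear_right: "linear (\<omega> p X)"
proof -
  have "\<omega> p X = (\<lambda>Y. - \<omega> p Y X)" using antisymmetric by blast
  then show ?thesis using linear_compose_neg[OF linear_left] by simp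
qed

lemma alternating: "\<omega> p X X = 0"
  using antisymmetric[of p X X] by (simp add: eq_neg_iff_add_eq_0 scaleR_2[symmetric])

lemma linear_star_left: "linear (\<lambda>V. star \<omega> p V X)"
  unfolding star_def
  by (rule linearI) (simp_all add: linear_add[OF linear_vol4_4] linear_scale[OF linear_vol4_4]
      algebra_simps sum.distrib scaleR_sum_right)

lemma linear_star_right: "linear (star \<omega> p V)"
  unfolding star_def
  by (rule linearI) (simp_all add: linear_add[OF linear_vol4_3] linear_scale[OF linear_vol4_3]
      algebra_simps sum.distrib scaleR_sum_right)

lemma star_alternating: "star \<omega> p V V = 0"
  by (simp add: star_def vol4_eq_zero)

lemma contraction_coordinates:
  assumes x: "coordinate_system x" "p \<in> fst x"
  shows "contraction \<psi> \<omega> p X = (\<Sum>a\<in>UNIV. vcomp x p X a *\<^sub>R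
    (\<Sum>b\<in>UNIV. vcomp x p (\<psi> p) b *\<^sub>R \<omega> p (coord_field x p b) (coord_field x p a)))"
  unfolding contraction_def
  by (subst linear_eq_coord_sum[OF x linear_right], subst linear_eq_coord_sum[OF x linear_left])
    (rule refl)

text \<open>\<open>star\<close> contains two contractions with the inverse metric, over
  \<open>l\<close>, \<open>b\<close> and over \<open>k\<close>, \<open>a\<close>;
  \<open>metric_trace\<close> moves each of them to the given coordinates.\<close>

lemma star_coord_field:
  assumes x: "coordinate_system x" "p \<in> fst x"
  shows "star \<omega> p (coord_field x p n) (coord_field x p m)
    = (\<Sum>k\<in>UNIV. \<Sum>l\<in>UNIV. eps_up x p k l m n *\<^sub>R \<omega> p (coord_field x p k) (coord_field x p l))"
proof -
  let ?e = "coord_field x p" and ?g = "\<lambda>a b. metric_inv x p $ a $ b"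
  let ?v = "\<lambda>u v. vol4 u v (?e m) (?e n)"
  \<comment> \<open>The inner contraction, kept as a bilinear map in the two vectors of the outer
    one: \<open>u\<close> goes into the form, \<open>v\<close> into the volume.\<close>
  define h where "h u v = (\<Sum>l\<in>UNIV. \<Sum>b\<in>UNIV. ?g l b *\<^sub>R ?v v (?e b) *\<^sub>R \<omega> p u (?e l))" for u v
  have inner: "(\<Sum>l\<in>UNIV. \<Sum>b\<in>UNIV. eta l b *\<^sub>R ?v v (axis b 1) *\<^sub>R \<omega> p u (axis l 1)) = h u v" for u v
    unfolding h_def
    by (rule metric_trace[OF x])
      (auto intro!: linearI simp: linear_add[OF linear_right] linear_scale[OF linear_right]
        linear_add[OF linear_vol4_2] linear_scale[OF linear_vol4_2] algebra_simps)
  have "star \<omega> p (?e n) (?e m)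
      = (\<Sum>k\<in>UNIV. \<Sum>l\<in>UNIV. \<Sum>a\<in>UNIV. \<Sum>b\<in>UNIV.
          (eta k a * eta l b * ?v (axis a 1) (axis b 1)) *\<^sub>R \<omega> p (axis k 1) (axis l 1))"
    by (simp only: star_def)
  also have "\<dots> = (\<Sum>k\<in>UNIV. \<Sum>a\<in>UNIV. \<Sum>l\<in>UNIV. \<Sum>b\<in>UNIV.
          (eta k a * eta l b * ?v (axis a 1) (axis b 1)) *\<^sub>R \<omega> p (axis k 1) (axis l 1))"
    by (intro sum.cong refl sum.swap)
  also have "\<dots> = (\<Sum>k\<in>UNIV. \<Sum>a\<in>UNIV. eta k a *\<^sub>R h (axis k 1) (axis a 1))"
    unfolding inner[symmetric] by (simp add: scaleR_sum_right mult.assoc)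
  also have "\<dots> = (\<Sum>k\<in>UNIV. \<Sum>a\<in>UNIV. ?g k a *\<^sub>R h (?e k) (?e a))"
    by (rule metric_trace[OF x])
      (auto intro!: linearI simp: h_def linear_add[OF linear_left] linear_scale[OF linear_left]
        linear_add[OF linear_vol4_1] linear_scale[OF linear_vol4_1] algebra_simps sum.distrib
        scaleR_sum_right)
  also have "\<dots> = (\<Sum>k\<in>UNIV. \<Sum>a\<in>UNIV. \<Sum>l\<in>UNIV. \<Sum>b\<in>UNIV.
      (?g k a * ?g l b * ?v (?e a) (?e b)) *\<^sub>R \<omega> p (?e k) (?e l))"
    by (simp add: h_def scaleR_sum_right mult.assoc)
  also have "\<dots> = (\<Sum>k\<in>UNIV. \<Sum>l\<in>UNIV. \<Sum>a\<in>UNIV. \<Sum>b\<in>UNIV.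
      (?g k a * ?g l b * ?v (?e a) (?e b)) *\<^sub>R \<omega> p (?e k) (?e l))"
    by (intro sum.cong refl sum.swap)
  also have "\<dots> = (\<Sum>k\<in>UNIV. \<Sum>l\<in>UNIV. eps_up x p k l m n *\<^sub>R \<omega> p (?e k) (?e l))"
    by (simp add: eps_up_def eps_eq_vol4[OF x] scaleR_sum_left)
  finally show ?thesis .
qed

lemma contraction_star_coord_field:
  assumes x: "coordinate_system x" "p \<in> fst x"
  shows "contraction \<psi> (star \<omega>) p (coord_field x p m)
    = (\<Sum>k\<in>UNIV. \<Sum>l\<in>UNIV. \<Sum>n\<in>UNIV. (eps_up x p k l m n * vcomp x p (\<psi> p) n) *\<^sub>R
         \<omega> p (coord_field x p k) (coord_field x p l))"
proof -
  let ?e = "coord_field x p"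
  have "contraction \<psi> (star \<omega>) p (?e m)
      = (\<Sum>n\<in>UNIV. vcomp x p (\<psi> p) n *\<^sub>R star \<omega> p (?e n) (?e m))"
    unfolding contraction_def by (rule linear_eq_coord_sum[OF x linear_star_left])
  also have "\<dots> = (\<Sum>n\<in>UNIV. \<Sum>k\<in>UNIV. \<Sum>l\<in>UNIV.
      (eps_up x p k l m n * vcomp x p (\<psi> p) n) *\<^sub>R \<omega> p (?e k) (?e l))"
    by (simp add: star_coord_field[OF x] scaleR_sum_right mult.commute)
  also have "\<dots> = (\<Sum>k\<in>UNIV. \<Sum>n\<in>UNIV. \<Sum>l\<in>UNIV.
      (eps_up x p k l m n * vcomp x p (\<psi> p) n) *\<^sub>R \<omega> p (?e k) (?e l))"
    by (rule sum.swap)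
  also have "\<dots> = (\<Sum>k\<in>UNIV. \<Sum>l\<in>UNIV. \<Sum>n\<in>UNIV.
      (eps_up x p k l m n * vcomp x p (\<psi> p) n) *\<^sub>R \<omega> p (?e k) (?e l))"
    by (intro sum.cong refl sum.swap)
  finally show ?thesis .
qed

lemma contraction_star_coordinates:
  assumes x: "coordinate_system x" "p \<in> fst x"
  shows "contraction \<psi> (star \<omega>) p X = (\<Sum>m\<in>UNIV. vcomp x p X m *\<^sub>R
    (\<Sum>k\<in>UNIV. \<Sum>l\<in>UNIV. \<Sum>n\<in>UNIV. (eps_up x p k l m n * vcomp x p (\<psi> p) n) *\<^sub>R
       \<omega> p (coord_field x p k) (coord_field x p l)))"
proof -
  have "contraction \<psi> (star \<omega>) p X
      = (\<Sum>m\<in>UNIV. vcomp x p X m *\<^sub>R contraction \<psi> (star \<omega>) p (coord_field x p m))"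
    unfolding contraction_def by (rule linear_eq_coord_sum[OF x linear_star_right])
  then show ?thesis by (simp only: contraction_star_coord_field[OF x])
qed

end

text \<open>Gathers the analysis on the manifold; afterwards the curvature enters only as a
  \<open>two_form\<close>, together with the spin conditions imposed on its torsion.\<close>

lemma (in quantum_superalgebra) two_form_observed_curvature:
  fixes atlas :: "('m::t2_space, 'a, 'd::finite) qchart set"
    and \<mu> :: "('m, 'a, 'd) qchart \<Rightarrow> 'm \<Rightarrow> 'a^'d \<Rightarrow> 'a^'k::finite"
  assumes "quantum_supermanifold atlas" "quantum_connection atlas \<mu>" "relativistic_frame atlas i \<psi>"
  shows "two_form (observed_curvature atlas C \<mu> i)"
  by (rule two_form.intro) (rule linear_observed_curvature[OF assms] observed_curvature_swap)+

section \<open>Adapted coordinates\<close>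

context
  fixes \<psi> :: "real^4 \<Rightarrow> real^4" and x :: nchart and p :: "real^4"
  assumes ad: "adapted \<psi> x" and p: "p \<in> fst x"
begin

lemma adapted_coords: "coordinate_system x"
  using ad by (simp add: adapted_def)

lemma vcomp_adapted: "vcomp x p (\<psi> p) a = (if a = 0 then 1 else 0)"
  using ad p vcomp_coord_field[OF adapted_coords p] by (simp add: adapted_def)

text \<open>Row 0 of the metric is a unit row, so row 0 of its product with the inverse is row 0 of
  the inverse.\<close>

lemma metric_inv_adapted: "metric_inv x p $ 0 $ a = (if a = 0 then 1 else 0)"
proof -
  have g: "gmat x p $ 0 $ k = (if k = 0 then 1 else 0)" for k
    using ad p by (simp add: adapted_def)
  have "(gmat x p ** metric_inv x p) $ 0 $ a = metric_inv x p $ 0 $ a"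
    by (simp add: matrix_matrix_mult_def g if_distrib[of "\<lambda>y. y * _"] cong: if_cong)
  then show ?thesis
    by (auto simp: gmat_metric_inv[OF adapted_coords p] mat_def)
qed

text \<open>Raising a time index leaves it a time index, and \<open>eps\<close> then contains 0
  twice.\<close>

lemma eps_up_adapted: "eps_up x p 0 l m 0 = 0" "eps_up x p k 0 m 0 = 0"
proof -
  have z: "eps x p 0 b m 0 = 0" "eps x p a 0 m 0 = 0" for a b
    using vol4_swap_12[of "coord_field x p a" "coord_field x p 0" "coord_field x p m" "coord_field x p 0"]
    by (simp_all add: eps_eq_vol4[OF adapted_coords p] vol4_eq_zero)
  show "eps_up x p 0 l m 0 = 0" "eps_up x p k 0 m 0 = 0"
    unfolding eps_up_def metric_inv_adapted
    by (rule sum.neutral; rule ballI; rule sum.neutral; simp add: z)+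
qed

lemma eps_up_adapted_time: "eps_up x p k l 0 0 = 0"
  by (simp add: eps_up_def eps_eq_vol4[OF adapted_coords p] vol4_eq_zero)

text \<open>The velocity leaves only the time index in the first slot of \<open>eps\<close>, where
  it repeats the last one.\<close>

lemma spin_vector_adapted_time: "spin_vector \<psi> s x p 0 = 0"
  unfolding spin_vector_def vcomp_adapted
  by (rule sum.neutral; rule ballI; rule sum.neutral; rule ballI; rule sum.neutral)
    (simp add: eps_eq_vol4[OF adapted_coords p] vol4_eq_zero)

end

lemma (in two_form) contraction_adapted:
  assumes ad: "adapted \<psi> x" and p: "p \<in> fst x"
  shows "contraction \<psi> \<omega> p X
    = (\<Sum>j\<in>{1,2,3}. vcomp x p X j *\<^sub>R \<omega> p (coord_field x p 0) (coord_field x p j))"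
proof -
  have "(\<Sum>b\<in>UNIV. vcomp x p (\<psi> p) b *\<^sub>R \<omega> p (coord_field x p b) (coord_field x p a))
      = \<omega> p (coord_field x p 0) (coord_field x p a)" for a
    by (simp add: vcomp_adapted[OF ad p] if_distrib[of "\<lambda>r. r *\<^sub>R _"] cong: if_cong)
  then show ?thesis
    unfolding contraction_coordinates[OF adapted_coords[OF ad p] p]
    by (simp add: sum_UNIV_4 alternating)
qed

text \<open>The velocity fixes the last index of \<open>eps_up\<close> to 0; every term with a
  further time index repeats it and vanishes.\<close>

lemma (in two_form) contraction_star_adapted:
  assumes ad: "adapted \<psi> x" and p: "p \<in> fst x"
  shows "contraction \<psi> (star \<omega>) p X
    = (\<Sum>m\<in>{1,2,3}. vcomp x p X m *\<^sub>R (\<Sum>r\<in>{1,2,3}. \<Sum>s\<in>{1,2,3}. eps_up x p r s m 0 *\<^sub>R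
        \<omega> p (coord_field x p r) (coord_field x p s)))"
proof -
  let ?e = "coord_field x p"
  have "(\<Sum>n\<in>UNIV. (eps_up x p k l m n * vcomp x p (\<psi> p) n) *\<^sub>R \<omega> p (?e k) (?e l))
      = eps_up x p k l m 0 *\<^sub>R \<omega> p (?e k) (?e l)" for k l m
    by (simp add: vcomp_adapted[OF ad p] if_distrib[of "\<lambda>r. _ * r"] if_distrib[of "\<lambda>r. r *\<^sub>R _"]
        cong: if_cong)
  then show ?thesis
    unfolding contraction_star_coordinates[OF adapted_coords[OF ad p] p]
    by (simp add: sum_UNIV_4 eps_up_adapted[OF ad p] eps_up_adapted_time[OF ad p])
qed

section \<open>Spin structures\<close>

lemma vierbein_inv_mutually_inverse:
  assumes "invertible_vierbein Kv \<theta>" "coordinate_system x" "p \<in> fst x"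
  shows "mutually_inverse Kv UNIV (\<lambda>K a. \<theta> p (coord_field x p a) $ K) (vierbein_inv Kv \<theta> x p)"
  using assms unfolding invertible_vierbein_def vierbein_inv_def
  by (metis (no_types, lifting) someI_ex)

text \<open>Multiply the hypothesis from the left by the vierbein; the order of the factors is kept
  because the algebra is not commutative.\<close>

lemma vierbein_inv_cancel:
  assumes inv: "invertible_vierbein Kv \<theta>" "coordinate_system x" "p \<in> fst x"
    and zero: "\<And>l. (\<Sum>K\<in>Kv. vierbein_inv Kv \<theta> x p l K * v $ K) = 0"
    and h: "h \<in> Kv"
  shows "v $ h = 0"
proof -
  let ?W = "vierbein_inv Kv \<theta> x p" and ?T = "\<lambda>K a. \<theta> p (coord_field x p a) $ K"
  have "v $ h = (\<Sum>K\<in>Kv. (if h = K then 1 else 0) * v $ K)"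
    using h by (simp add: if_distrib[of "\<lambda>y. y * _"] cong: if_cong)
  also have "\<dots> = (\<Sum>K\<in>Kv. (\<Sum>l\<in>UNIV. ?T h l * ?W l K) * v $ K)"
    using vierbein_inv_mutually_inverse[OF inv] h by (simp add: mutually_inverse_def)
  also have "\<dots> = (\<Sum>l\<in>UNIV. ?T h l * (\<Sum>K\<in>Kv. ?W l K * v $ K))"
    by (simp add: sum_distrib_left sum_distrib_right mult.assoc) (rule sum.swap)
  also have "\<dots> = 0" by (simp add: zero)
  finally show ?thesis .
qed

lemma sum_summand: "(\<Sum>K\<in>S. w K * summand S v $ K) = (\<Sum>K\<in>S. w K * v $ K)"
  by (intro sum.cong) (simp_all add: summand_def)

text \<open>Contracting the torsion with the velocity gives the inverse vierbein applied to the
  electric part. The second spin condition makes this zero, and the inverse vierbein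
  cancels.\<close>

lemma spin_electric_zero:
  fixes R :: "real^4 \<Rightarrow> real^4 \<Rightarrow> real^4 \<Rightarrow> 'a::real_algebra_1 ^ 'k::finite"
  assumes R: "two_form R" and inv: "invertible_vierbein Kv \<theta>" and s: "spin_structure Kv \<theta> R \<psi> s"
  shows "summand Kv (contraction \<psi> R p X) = 0"
proof -
  interpret two_form R by (rule R)
  \<comment> \<open>The claim does not mention coordinates, so the global inertial chart may be used
    at every point.\<close>
  define x :: nchart where "x = (UNIV, id)"
  have x: "coordinate_system x" "p \<in> fst x" by (simp_all add: x_def coordinate_system_id)
  let ?e = "coord_field x p" and ?W = "vierbein_inv Kv \<theta> x p"
  have z: "R p (\<psi> p) (?e b) $ h = 0" if "h \<in> Kv" for b h
  proof (rule vierbein_inv_cancel[OF inv x _ that])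
    fix l
    have "(\<Sum>K\<in>Kv. ?W l K * R p (\<psi> p) (?e b) $ K)
        = (\<Sum>K\<in>Kv. \<Sum>a\<in>UNIV. vcomp x p (\<psi> p) a *\<^sub>R (?W l K * R p (?e a) (?e b) $ K))"
      by (subst linear_eq_coord_sum[OF x linear_left, of _ "\<psi> p"])
        (simp add: sum_distrib_left)
    also have "\<dots> = (\<Sum>a\<in>UNIV. vcomp x p (\<psi> p) a *\<^sub>R torsion Kv \<theta> R x p l a b)"
      by (subst sum.swap) (simp add: torsion_def sum_summand scaleR_sum_right)
    also have "\<dots> = 0" using s x unfolding spin_structure_def by blast
    finally show "(\<Sum>K\<in>Kv. ?W l K * R p (\<psi> p) (?e b) $ K) = 0" .
  qed
  have "R p (\<psi> p) X $ h = 0" if "h \<in> Kv" for h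
    by (subst linear_eq_coord_sum[OF x linear_right]) (simp add: z that)
  then show ?thesis by (simp add: contraction_def summand_def vec_eq_iff)
qed

text \<open>The velocity index stands first in the spin-vector and last in \<open>eps_up\<close>,
  which costs the sign of a four-cycle. Symmetry of the inverse metric allows the raising of indices
  to pass from \<open>s\<close> to the symbol.\<close>

lemma spin_vector_eq_eps_up:
  fixes s :: "real^4 \<Rightarrow> real^4 \<Rightarrow> real^4 \<Rightarrow> 'a::real_algebra_1"
  assumes x: "coordinate_system x" "p \<in> fst x"
  shows "spin_vector \<psi> s x p m = - (\<Sum>k\<in>UNIV. \<Sum>l\<in>UNIV. \<Sum>n\<in>UNIV.
    (eps_up x p k l m n * vcomp x p (\<psi> p) n) *\<^sub>R s p (coord_field x p k) (coord_field x p l))"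
proof -
  let ?e = "coord_field x p" and ?g = "\<lambda>a b. metric_inv x p $ a $ b"
    and ?\<psi> = "vcomp x p (\<psi> p)"
  let ?t = "\<lambda>n a b k l. (?g k a * ?g l b * eps x p a b m n * ?\<psi> n) *\<^sub>R s p (?e k) (?e l)"
  have rot: "eps x p n a b m = - eps x p a b m n" for n a b
    using vol4_rotate[of "?e a" "?e b" "?e m" "?e n"] by (simp add: eps_eq_vol4[OF x])
  have "spin_vector \<psi> s x p m
      = - (\<Sum>n\<in>UNIV. \<Sum>a\<in>UNIV. \<Sum>b\<in>UNIV. \<Sum>k\<in>UNIV. \<Sum>l\<in>UNIV. ?t n a b k l)"
    unfolding spin_vector_def rot
    by (simp add: scaleR_sum_right sum_negf metric_inv_sym[OF x] ac_simps)
  also have "(\<Sum>n\<in>UNIV. \<Sum>a\<in>UNIV. \<Sum>b\<in>UNIV. \<Sum>k\<in>UNIV. \<Sum>l\<in>UNIV. ?t n a b k l)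
      = (\<Sum>(n,a,b,k,l)\<in>UNIV. ?t n a b k l)"
    by (simp only: UNIV_Times_UNIV[symmetric] sum.cartesian_product split_def fst_conv snd_conv)
  \<comment> \<open>Five nested sums become one sum over tuples, so a single bijection performs the
    whole reordering.\<close>
  also have "\<dots> = (\<Sum>(k,l,n,a,b)\<in>UNIV. ?t n a b k l)"
    by (rule sum.reindex_bij_witness[where i = "\<lambda>(k,l,n,a,b). (n,a,b,k,l)"
          and j = "\<lambda>(n,a,b,k,l). (k,l,n,a,b)"]) auto
  also have "\<dots> = (\<Sum>k\<in>UNIV. \<Sum>l\<in>UNIV. \<Sum>n\<in>UNIV. \<Sum>a\<in>UNIV. \<Sum>b\<in>UNIV. ?t n a b k l)"
    by (simp only: UNIV_Times_UNIV[symmetric] sum.cartesian_product split_def fst_conv snd_conv)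
  also have "\<dots> = (\<Sum>k\<in>UNIV. \<Sum>l\<in>UNIV. \<Sum>n\<in>UNIV. (eps_up x p k l m n * ?\<psi> n) *\<^sub>R s p (?e k) (?e l))"
    by (simp add: eps_up_def sum_distrib_right scaleR_sum_left)
  finally show ?thesis .
qed

text \<open>The inverse vierbein turns each curvature term of the contracted star into torsion, and
  the first spin condition splits the velocity component off from the 2-form
  \<open>s\<close>.\<close>

lemma spin_magnetic:
  fixes R :: "real^4 \<Rightarrow> real^4 \<Rightarrow> real^4 \<Rightarrow> 'a::real_algebra_1 ^ 'k::finite"
  assumes R: "two_form R" and s: "spin_structure Kv \<theta> R \<psi> s"
    and x: "coordinate_system x" "p \<in> fst x"
  shows "(\<Sum>K\<in>Kv. vierbein_inv Kv \<theta> x p g K *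
      summand Kv (contraction \<psi> (star R) p (coord_field x p m)) $ K)
    = - (vcomp x p (\<psi> p) g *\<^sub>R spin_vector \<psi> s x p m)"
proof -
  interpret two_form R by (rule R)
  let ?e = "coord_field x p" and ?W = "vierbein_inv Kv \<theta> x p"
  let ?c = "\<lambda>k l n. eps_up x p k l m n * vcomp x p (\<psi> p) n"
  have tors: "torsion Kv \<theta> R x p g k l = vcomp x p (\<psi> p) g *\<^sub>R s p (?e k) (?e l)" for k l
    using s x unfolding spin_structure_def by blast
  \<comment> \<open>The coefficients built from the symbol and the velocity are real, so they pass
    through multiplication by the inverse vierbein.\<close>
  have lin: "linear (\<lambda>v. \<Sum>K\<in>Kv. ?W g K * v $ K)"
    by (rule linearI) (simp_all add: algebra_simps sum.distrib scaleR_sum_right)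
  have "(\<Sum>K\<in>Kv. ?W g K * summand Kv (contraction \<psi> (star R) p (?e m)) $ K)
      = (\<Sum>k\<in>UNIV. \<Sum>l\<in>UNIV. \<Sum>n\<in>UNIV. ?c k l n *\<^sub>R (\<Sum>K\<in>Kv. ?W g K * R p (?e k) (?e l) $ K))"
    unfolding sum_summand contraction_star_coord_field[OF x]
    by (simp only: linear_sum[OF lin] linear_scale[OF lin])
  also have "\<dots> = (\<Sum>k\<in>UNIV. \<Sum>l\<in>UNIV. \<Sum>n\<in>UNIV. ?c k l n *\<^sub>R vcomp x p (\<psi> p) g *\<^sub>R s p (?e k) (?e l))"
    by (simp only: tors[symmetric] torsion_def sum_summand)
  also have "\<dots> = - (vcomp x p (\<psi> p) g *\<^sub>R spin_vector \<psi> s x p m)"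
    by (simp add: spin_vector_eq_eps_up[OF x] scaleR_sum_right mult.commute)
  finally show ?thesis .
qed

section \<open>Splitting into the three summands and final assembly\<close>

lemma summand_splitting:
  fixes v :: "'a::ring_1 ^ 'k::finite"
  assumes "Kv \<inter> KL = {}"
  shows "v = summand Kv v + summand KL v + summand (- (Kv \<union> KL)) v"
  using assms by (auto simp: vec_eq_iff summand_def)

theorem theorem3p20:
  fixes smul :: "'f::real_normed_field
      \<Rightarrow> 'a::{real_algebra_1, t2_space, topological_ab_group_add, topological_semigroup_mult} \<Rightarrow> 'a"
    and A0 A1 :: "'a set"
    and atlas :: "('m::t2_space, 'a, 'd::finite) qchart set"
    and Kv KL :: "'k::finite set" and odd_idx :: "'k \<Rightarrow> bool"
    and gen :: "'k \<Rightarrow> (real^4^4) \<times> (real^4)"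
    and C :: "'k \<Rightarrow> 'k \<Rightarrow> 'k \<Rightarrow> 'a"
    and \<kappa> :: "'k \<Rightarrow> 'k \<Rightarrow> 'a"
    and G :: "('m, 'a, 'd) qchart \<Rightarrow> 'm \<Rightarrow> 'a^'d \<Rightarrow> 'a^'d \<Rightarrow> 'a"
    and \<mu> :: "('m, 'a, 'd) qchart \<Rightarrow> 'm \<Rightarrow> 'a^'d \<Rightarrow> 'a^'k"
    and i :: "real^4 \<Rightarrow> 'm" and \<psi> :: "real^4 \<Rightarrow> real^4" and hbar :: real
    and \<theta> E B :: "real^4 \<Rightarrow> real^4 \<Rightarrow> 'a^'k"
    and R :: "real^4 \<Rightarrow> real^4 \<Rightarrow> real^4 \<Rightarrow> 'a^'k"
  defines "\<theta> \<equiv> observed_vierbein atlas Kv \<mu> i"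
    and "R \<equiv> observed_curvature atlas C \<mu> i"
    and "E \<equiv> contraction \<psi> R"
    and "B \<equiv> contraction \<psi> (star R)"
  assumes "quantum_superalgebra smul A0 A1"
    and "quantum_supermanifold atlas"
    and "poincare_superextension A0 A1 Kv KL odd_idx gen C"
    and "quantum_metric atlas G"
    and "\<exists>W. mutually_inverse UNIV UNIV \<kappa> W"
    and "quantum_connection atlas \<mu>"
    and "vierbein atlas Kv \<mu>"
    and "yang_mills atlas \<kappa> G C \<mu>"
    and "relativistic_frame atlas i \<psi>"
    and "invertible_vierbein Kv \<theta>"
    and "hbar > 0"
  shows
    "(\<forall>p. linear (E p) \<and> linear (B p)) \<and>
     (\<forall>x. coordinate_system x \<longrightarrow> (\<forall>p\<in>fst x. \<forall>X K.
        E p X $ K = (\<Sum>a\<in>UNIV. vcomp x p X a *\<^sub>R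
          (\<Sum>b\<in>UNIV. vcomp x p (\<psi> p) b *\<^sub>R R p (coord_field x p b) (coord_field x p a) $ K)) \<and>
        B p X $ K = (\<Sum>m\<in>UNIV. vcomp x p X m *\<^sub>R
          (\<Sum>k\<in>UNIV. \<Sum>l\<in>UNIV. \<Sum>n\<in>UNIV. (eps_up x p k l m n * vcomp x p (\<psi> p) n) *\<^sub>R
             R p (coord_field x p k) (coord_field x p l) $ K)))) \<and>
     (\<forall>x. adapted \<psi> x \<longrightarrow> (\<forall>p\<in>fst x. \<forall>X K.
        E p X $ K = (\<Sum>j\<in>{1,2,3}. vcomp x p X j *\<^sub>R R p (coord_field x p 0) (coord_field x p j) $ K) \<and>
        B p X $ K = (\<Sum>m\<in>{1,2,3}. vcomp x p X m *\<^sub>R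
          (\<Sum>r\<in>{1,2,3}. \<Sum>s\<in>{1,2,3}. eps_up x p r s m 0 *\<^sub>R
             R p (coord_field x p r) (coord_field x p s) $ K)))) \<and>
     (\<forall>p. E p (\<psi> p) = 0 \<and> B p (\<psi> p) = 0) \<and>
     (\<forall>p X. E p X = summand Kv (E p X) + summand KL (E p X) + summand (- (Kv \<union> KL)) (E p X) \<and>
            B p X = summand Kv (B p X) + summand KL (B p X) + summand (- (Kv \<union> KL)) (B p X)) \<and>
     (\<forall>s. spin_structure Kv \<theta> R \<psi> s \<longrightarrow>
        (\<forall>p X. summand Kv (E p X) = 0) \<and>
        (\<forall>x. coordinate_system x \<longrightarrow> (\<forall>p\<in>fst x. \<forall>g m.
           (\<Sum>K\<in>Kv. vierbein_inv Kv \<theta> x p g K * summand Kv (B p (coord_field x p m)) $ K)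
             = - (vcomp x p (\<psi> p) g *\<^sub>R spin_vector \<psi> s x p m))) \<and>
        (\<forall>x. adapted \<psi> x \<longrightarrow> (\<forall>p\<in>fst x.
           let Bv0 = (\<lambda>j. \<Sum>K\<in>Kv. vierbein_inv Kv \<theta> x p 0 K * summand Kv (B p (coord_field x p j)) $ K)
           in (\<forall>j\<in>{1,2,3}. Bv0 j = - spin_vector \<psi> s x p j) \<and>
              (\<forall>k\<in>{1,2,3}.
                 raise x p (spin_vector \<psi> s x p) k
                   = (\<Sum>j\<in>{1,2,3}. metric_inv x p $ k $ j *\<^sub>R spin_vector \<psi> s x p j) \<and>
                 raise x p (spin_vector \<psi> s x p) k
                   = (\<Sum>j\<in>{1,2,3}. metric_inv x p $ k $ j *\<^sub>R (- Bv0 j))) \<and>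
              spin_classification smul hbar x p (spin_vector \<psi> s x p)
                = spin_classification smul hbar x p (\<lambda>j. - Bv0 j))))"
proof -
  interpret quantum_superalgebra smul A0 A1 by fact
  have R: "two_form R"
    unfolding R_def by (rule two_form_observed_curvature) fact+
  interpret two_form R by (rule R)
  \<comment> \<open>The four defining equations come first in \<open>assms\<close>, so number 7 is
    the superextension.\<close>
  have disj: "Kv \<inter> KL = {}"
    using assms(7) by (simp add: poincare_superextension_def Let_def)
  have lin: "linear (E p)" "linear (B p)" for p
    unfolding E_def B_def contraction_def[abs_def] by (rule linear_right linear_star_right)+
  have coords: "E p X $ K = (\<Sum>a\<in>UNIV. vcomp x p X a *\<^sub>R
          (\<Sum>b\<in>UNIV. vcomp x p (\<psi> p) b *\<^sub>R R p (coord_field x p b) (coord_field x p a) $ K))"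
    "B p X $ K = (\<Sum>m\<in>UNIV. vcomp x p X m *\<^sub>R
          (\<Sum>k\<in>UNIV. \<Sum>l\<in>UNIV. \<Sum>n\<in>UNIV. (eps_up x p k l m n * vcomp x p (\<psi> p) n) *\<^sub>R
             R p (coord_field x p k) (coord_field x p l) $ K))"
    if x: "coordinate_system x" "p \<in> fst x" for x p X K
    unfolding E_def B_def contraction_coordinates[OF x] contraction_star_coordinates[OF x]
    by simp_all
  have adapted: "E p X $ K = (\<Sum>j\<in>{1,2,3}. vcomp x p X j *\<^sub>R R p (coord_field x p 0) (coord_field x p j) $ K)"
    "B p X $ K = (\<Sum>m\<in>{1,2,3}. vcomp x p X m *\<^sub>R
          (\<Sum>r\<in>{1,2,3}. \<Sum>s\<in>{1,2,3}. eps_up x p r s m 0 *\<^sub>R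
             R p (coord_field x p r) (coord_field x p s) $ K))"
    if x: "adapted \<psi> x" "p \<in> fst x" for x p X K
    unfolding E_def B_def contraction_adapted[OF x] contraction_star_adapted[OF x]
    by (simp_all only: sum_component vector_scaleR_component)
  \<comment> \<open>Each contraction with the velocity inserts it twice into an alternating form,
    which makes both fields space-like.\<close>
  have space: "E p (\<psi> p) = 0" "B p (\<psi> p) = 0" for p
    by (simp_all add: E_def B_def contraction_def alternating star_alternating)
  have Ev: "summand Kv (E p X) = 0" if "spin_structure Kv \<theta> R \<psi> s" for s p X
    unfolding E_def using R \<open>invertible_vierbein Kv \<theta>\<close> that by (rule spin_electric_zero)
  have Bv: "(\<Sum>K\<in>Kv. vierbein_inv Kv \<theta> x p g K * summand Kv (B p (coord_field x p m)) $ K)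
      = - (vcomp x p (\<psi> p) g *\<^sub>R spin_vector \<psi> s x p m)"
    if "spin_structure Kv \<theta> R \<psi> s" "coordinate_system x" "p \<in> fst x" for s x p g m
    unfolding B_def using R that by (rule spin_magnetic)
  have Bv0: "(\<Sum>K\<in>Kv. vierbein_inv Kv \<theta> x p 0 K * summand Kv (B p (coord_field x p j)) $ K)
      = - spin_vector \<psi> s x p j"
    if "spin_structure Kv \<theta> R \<psi> s" "adapted \<psi> x" "p \<in> fst x" for s x p j
    using Bv[OF that(1) adapted_coords[OF that(2,3)] that(3)] by (simp add: vcomp_adapted[OF that(2,3)])
  \<comment> \<open>The sum over all indices reduces to spatial ones because the time component of
    the spin-vector is zero.\<close>
  have raise: "raise x p (spin_vector \<psi> s x p) k
      = (\<Sum>j\<in>{1,2,3}. metric_inv x p $ k $ j *\<^sub>R spin_vector \<psi> s x p j)"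
    if "adapted \<psi> x" "p \<in> fst x" for s :: "real^4 \<Rightarrow> real^4 \<Rightarrow> real^4 \<Rightarrow> 'a" and x p k
    unfolding raise_def by (simp only: sum_UNIV_4 spin_vector_adapted_time[OF that]) simp
  \<comment> \<open>\<open>Bv0\<close> holds for every index, the time index included, so the
    negated components form the same function as the spin-vector and the two classifications
    coincide.\<close>
  show ?thesis
    unfolding Let_def
    by (intro conjI allI impI ballI lin coords adapted space summand_splitting[OF disj] Ev Bv)
      (simp_all only: Bv0 raise minus_minus)
qed

end
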